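(* Let $$z(s)=\frac12\int_0^1\Big[\big(f_+(4\sin^2(\pi x))^2\big)^s+\big(f_-(4\sin^2(\pi x))^2\big)^s\Big]\,dx,\qquad f_\pm(y)=\frac{y\pm\sqrt{y^2+4}}{2},\quad s\in\mathbb{C},$$ which is an entire function. Let $G=G_0$ be any $1$-dimensional finite abstract simplicial complex, let $G_n$ be its $n$-th Barycentric refinement, and let $\zeta_{G_n}(s)=\sum_k\lambda_k^{-s}$, where the $\lambda_k$ are the eigenvalues (with multiplicity) of $L(G_n)^2$ and $L(G_n)$ is the connection Laplacian of $G_n$. Then: (1) the functions $\zeta_{G_n}(s)/|G_n|$ converge to $z(s)$ as $n\to\infty$, uniformly on compact subsets of $\mathbb{C}$; (2) the roots of $\zeta_{G_n}$ converge weakly to the roots of $z$: if $\mu_n$ (respectively $\mu$) is the measure on $\mathbb{C}$ which is the sum of Dirac unit masses at the roots, counted with multiplicity, of $\zeta_{G_n}$ (respectively $z$), then $\int\varphi\,d\mu_n\to\int\varphi\,d\mu$ for every continuous compactly supported $\varphi:\mathbb{C}\to\mathbb{R}$.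
   Context: A finite abstract simplicial complex $G$ is a finite set of non-empty finite sets (simplices) closed under taking non-empty subsets; $|G|$ is the number of its simplices. It is $1$-dimensional if every $x\in G$ has $|x|\le2$ and at least one $x\in G$ has $|x|=2$. The connection Laplacian $L(G)$ is the $|G|\times|G|$ matrix indexed by $G$ with $L(x,y)=1$ if $x\cap y\ne\emptyset$ and $0$ otherwise; it is known to satisfy $|\det L(G)|=1$, so $L(G)^2$ is positive definite and real logarithms are used to define powers. The Barycentric refinement $G_{n+1}$ of $G_n$ is the Whitney complex (the set of vertex sets of all non-empty complete subgraphs) of the graph whose vertices are the elements of $G_n$ and in which two distinct vertices are connected if one is contained in the other. *)

theory Defs
  imports
    "HOL-Complex_Analysis.Complex_Analysis"
    "HOL-Library.FSet"
    "Jordan_Normal_Form.Char_Poly"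
begin

definition finite_simplicial_complex :: "'a set set \<Rightarrow> bool" where
  "finite_simplicial_complex G \<longleftrightarrow>
     finite G \<and> (\<forall>x\<in>G. finite x \<and> x \<noteq> {}) \<and> (\<forall>x\<in>G. \<forall>y. y \<subseteq> x \<and> y \<noteq> {} \<longrightarrow> y \<in> G)"

definition one_dimensional :: "'a set set \<Rightarrow> bool" where
  "one_dimensional G \<longleftrightarrow> (\<forall>x\<in>G. card x \<le> 2) \<and> (\<exists>x\<in>G. card x = 2)"

definition whitney_complex :: "'v set \<Rightarrow> ('v \<Rightarrow> 'v \<Rightarrow> bool) \<Rightarrow> 'v set set" where
  "whitney_complex V adj =
     {K. K \<subseteq> V \<and> finite K \<and> K \<noteq> {} \<and> (\<forall>u\<in>K. \<forall>v\<in>K. u \<noteq> v \<longrightarrow> adj u v)}"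

definition barycentric_refinement :: "'a set set \<Rightarrow> 'a set set set" where
  "barycentric_refinement G = whitney_complex G (\<lambda>x y. x \<noteq> y \<and> (x \<subseteq> y \<or> y \<subseteq> x))"

text \<open>
  The refinement of a complex with vertices in \<open>'a\<close> has vertices in \<open>'a set\<close>, so it cannot be
  iterated at a fixed type. The type below contains the vertices of all iterated refinements:
  those of the original complex, and those which are (finite) simplices of a previous complex.
  The map \<open>simplex_vertex\<close>, injective on finite sets, merely renames a simplex as a vertex.
\<close>

datatype 'a vertex = Original 'a | Simplex "'a vertex fset"

definition simplex_vertex :: "'a vertex set \<Rightarrow> 'a vertex" where
  "simplex_vertex x = Simplex (Abs_fset x)"

lemma inj_on_simplex_vertex: "inj_on simplex_vertex {x. finite x}"
  by (auto simp: inj_on_def simplex_vertex_def Abs_fset_inject)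

primrec refined_complex :: "'a set set \<Rightarrow> nat \<Rightarrow> 'a vertex set set" where
  "refined_complex G 0 = (\<lambda>x. Original ` x) ` G"
| "refined_complex G (Suc n) =
     (\<lambda>c. simplex_vertex ` c) ` barycentric_refinement (refined_complex G n)"

lemma finite_simplicial_complex_image:
  assumes "finite_simplicial_complex G"
  shows "finite_simplicial_complex ((\<lambda>x. f ` x) ` G)"
  unfolding finite_simplicial_complex_def
proof (intro conjI ballI allI impI)
  show "finite ((\<lambda>x. f ` x) ` G)"
    using assms by (simp add: finite_simplicial_complex_def)
next
  fix x assume "x \<in> (\<lambda>x. f ` x) ` G"
  then show "finite x" "x \<noteq> {}"
    using assms by (auto simp: finite_simplicial_complex_def)
next
  fix x y assume "x \<in> (\<lambda>x. f ` x) ` G" and y: "y \<subseteq> x \<and> y \<noteq> {}"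
  then obtain x' where x': "x' \<in> G" "x = f ` x'" by blast
  with y obtain y' where y': "y' \<subseteq> x'" "y = f ` y'" by (meson subset_image_iff)
  with y have "y' \<noteq> {}" by blast
  with x'(1) y'(1) have "y' \<in> G"
    using assms unfolding finite_simplicial_complex_def by blast
  with y'(2) show "y \<in> (\<lambda>x. f ` x) ` G" by blast
qed

lemma finite_simplicial_complex_barycentric_refinement:
  assumes "finite_simplicial_complex G"
  shows "finite_simplicial_complex (barycentric_refinement G)"
proof -
  have "barycentric_refinement G \<subseteq> Pow G"
    by (auto simp: barycentric_refinement_def whitney_complex_def)
  then have "finite (barycentric_refinement G)"
    using assms by (auto simp: finite_simplicial_complex_def intro: finite_subset)
  moreover have "finite x \<and> x \<noteq> {}" if "x \<in> barycentric_refinement G" for x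
    using that by (simp add: barycentric_refinement_def whitney_complex_def)
  moreover have "y \<in> barycentric_refinement G"
    if x: "x \<in> barycentric_refinement G" and y: "y \<subseteq> x" "y \<noteq> {}" for x y
  proof -
    have "finite y" "y \<subseteq> G"
      using x y by (auto simp: barycentric_refinement_def whitney_complex_def intro: finite_subset[of y x])
    moreover have "\<forall>u\<in>y. \<forall>v\<in>y. u \<noteq> v \<longrightarrow> u \<noteq> v \<and> (u \<subseteq> v \<or> v \<subseteq> u)"
      using x subsetD[OF y(1)] by (simp add: barycentric_refinement_def whitney_complex_def)
    ultimately show ?thesis
      using y(2) by (simp add: barycentric_refinement_def whitney_complex_def)
  qed
  ultimately show ?thesis
    unfolding finite_simplicial_complex_def by blast
qed

lemma finite_simplicial_complex_refined_complex:
  assumes "finite_simplicial_complex G"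
  shows "finite_simplicial_complex (refined_complex G n)"
proof (induction n)
  case 0
  show ?case
    using assms by (simp add: finite_simplicial_complex_image)
next
  case (Suc n)
  then show ?case
    by (simp add: finite_simplicial_complex_image
        finite_simplicial_complex_barycentric_refinement)
qed

text \<open>
  Matrices are indexed by natural numbers, so the simplices are listed in some order. Another
  order conjugates the matrix by a permutation matrix and leaves its eigenvalues unchanged.
\<close>

definition simplex_list :: "'a set set \<Rightarrow> 'a set list" where
  "simplex_list G = (SOME xs. distinct xs \<and> set xs = G)"

lemma simplex_list:
  assumes "finite G"
  shows "distinct (simplex_list G)" "set (simplex_list G) = G"
proof -
  have "\<exists>xs. distinct xs \<and> set xs = G"
    using finite_distinct_list[OF assms] by blast
  from someI_ex[OF this] show "distinct (simplex_list G)" "set (simplex_list G) = G"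
    by (auto simp: simplex_list_def)
qed

definition connection_laplacian :: "'a set set \<Rightarrow> real mat" where
  "connection_laplacian G =
     mat (card G) (card G)
       (\<lambda>(i, j). if simplex_list G ! i \<inter> simplex_list G ! j \<noteq> {} then 1 else 0)"

text \<open>
  The eigenvalues of a real symmetric matrix are real, so the multiset of real roots of the
  characteristic polynomial consists of all eigenvalues, with multiplicity.
\<close>

definition eigenvalues :: "real mat \<Rightarrow> real multiset" where
  "eigenvalues A = proots (char_poly A)"

text \<open>
  On positive reals the principal complex logarithm used by \<open>powr\<close> is the real logarithm.
\<close>

definition connection_zeta :: "'a set set \<Rightarrow> complex \<Rightarrow> complex" where
  "connection_zeta G s =
     (\<Sum>l\<in>#eigenvalues (connection_laplacian G * connection_laplacian G).
        complex_of_real l powr (- s))"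

definition f_plus :: "real \<Rightarrow> real" where
  "f_plus y = (y + sqrt (y\<^sup>2 + 4)) / 2"

definition f_minus :: "real \<Rightarrow> real" where
  "f_minus y = (y - sqrt (y\<^sup>2 + 4)) / 2"

definition limit_zeta :: "complex \<Rightarrow> complex" where
  "limit_zeta s =
     1 / 2 * integral {0..1::real} (\<lambda>x.
       complex_of_real ((f_plus (4 * (sin (pi * x))\<^sup>2))\<^sup>2) powr s +
       complex_of_real ((f_minus (4 * (sin (pi * x))\<^sup>2))\<^sup>2) powr s)"

text \<open>
  The sum of the point masses at the roots of an entire function that is not identically zero,
  counted with multiplicity, as a Borel measure; at a root, \<open>zorder\<close> is the multiplicity.
\<close>

definition root_measure :: "(complex \<Rightarrow> complex) \<Rightarrow> complex measure" where
  "root_measure f =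
     distr (point_measure {w. f w = 0} (\<lambda>w. of_nat (nat (zorder f w)))) borel (\<lambda>w. w)"

end

theory Submission
  imports Defs "Jordan_Normal_Form.Schur_Decomposition"
begin

text \<open>
  Let \<open>N\<close> be the adjacency matrix of the graph on the simplices of a one-dimensional complex \<open>G\<close>
  in which two simplices are joined when one properly contains the other, and let \<open>P\<^sub>V\<close> and
  \<open>P\<^sub>E\<close> be the projections to vertices and edges. The square \<open>N\<^sup>2\<close> is block diagonal (it is the
  signless Hodge Laplacian), and counting common vertices gives the connection Laplacian as
  \<open>L = P\<^sub>V - P\<^sub>E + N + P\<^sub>E N\<^sup>2\<close> (\<open>connection_eq\<close>). As \<open>N\<close> exchanges vertices and edges, this yields
  \<open>L\<^sup>2 = N\<^sup>2 L + 1\<close> (\<open>connection_square\<close>), that is \<open>L - L\<^sup>-\<^sup>1 = N\<^sup>2\<close>. Two things follow. The traces of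
  all powers of \<open>L\<close> are determined by the traces of even powers of \<open>N\<close>, through the same two-term
  recursion that the powers of \<open>f\<^sub>\<plusminus>(y)\<close> satisfy. And \<open>L\<close> and its inverse have row sums bounded in
  terms of the largest vertex degree. Refinement keeps the degrees of the old vertices and gives
  degree 2 to the new ones, so at all levels the eigenvalues of \<open>L\<^sup>2\<close> lie in one interval \<open>[1/B, B]\<close>.

  The heart is what refinement does to \<open>N\<close>. The vertices of the refinement \<open>G'\<close> are the simplices of
  \<open>G\<close>, and on them \<open>N'\<^sup>2 = N + D\<close>, where the diagonal matrix \<open>D\<close> counts the simplices comparable to
  a given one (\<open>hasse_square_refinement\<close>). Every edge is comparable to exactly two vertices, and
  \<open>D = 2\<close> also at every vertex that subdivides an edge; the total deviation of \<open>D\<close> from \<open>2\<close> is the same at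
  all levels. Up to a bounded error, the trace of \<open>N'\<^sup>2\<^sup>j\<close> is therefore twice that of \<open>(2 + N)\<^sup>j\<close>,
  in which only the even powers of \<open>N\<close> of exponent at most \<open>j\<close> count, since odd powers have
  trace zero. The number of simplices doubles up to a constant. So the limit of the \<open>2j\<close>-th normalized
  moment of \<open>N\<close> is expressed through moments of order at most \<open>j\<close>, and induction on the order
  gives all limits. The moments of \<open>4 sin\<^sup>2(\<pi>x)\<close> obey the same recursion by the angle-doubling
  identity \<open>(2 cos \<theta>)\<^sup>2 = 2 + 2 cos 2\<theta>\<close>; hence they are the limits (\<open>trace_limit_0\<close>).

  Weierstrass approximation on \<open>[1/B, B]\<close> turns convergence of moments into pointwise convergence of
  the normalized zeta functions. They are Lipschitz on bounded sets with constants independent of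
  the level, which makes the convergence locally uniform. The sign of \<open>s\<close> in the limit is
  immaterial because \<open>f\<^sub>+ f\<^sub>- = -1\<close>. Finally, Rouche's theorem around each zero of the limit,
  which is not identically zero since its value at \<open>0\<close> is \<open>1\<close>, shows that zeros converge with
  their multiplicities (\<open>root_measures_converge\<close>).
\<close>

section \<open>Eigenvalues of real symmetric matrices\<close>

unbundle no fps_syntax
unbundle no vec_syntax

lemma eigenvector_function:
  fixes A :: "'a :: field mat"
  assumes A: "A \<in> carrier_mat n n" and root: "poly (char_poly A) l = 0"
  obtains u where "\<exists>i<n. u i \<noteq> 0" "\<And>i. i < n \<Longrightarrow> (\<Sum>j<n. A $$ (i, j) * u j) = l * u i"
proof -
  from root have "eigenvalue A l" using eigenvalue_root_char_poly[OF A] by simp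
  then obtain v where v: "v \<in> carrier_vec n" "v \<noteq> 0\<^sub>v n" "A *\<^sub>v v = l \<cdot>\<^sub>v v"
    using A by (auto simp: eigenvalue_def eigenvector_def)
  have "\<exists>i<n. v $ i \<noteq> 0"
  proof (rule ccontr)
    assume "\<not> ?thesis"
    then have "v = 0\<^sub>v n" using v(1) by (intro eq_vecI) auto
    with v(2) show False by simp
  qed
  moreover have "(\<Sum>j<n. A $$ (i, j) * v $ j) = l * v $ i" if "i < n" for i
  proof -
    have "(A *\<^sub>v v) $ i = (\<Sum>j<n. A $$ (i, j) * v $ j)"
      using A v(1) that by (simp add: scalar_prod_def atLeast0LessThan)
    then show ?thesis using v that by simp
  qed
  ultimately show ?thesis by (rule that[of "\<lambda>i. v $ i"])
qed

text \<open>
  For an eigenvector \<open>u\<close>, the number \<open>u\<^sup>* A u\<close> is its own conjugate and equals \<open>l\<close> times the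
  squared norm of \<open>u\<close>.
\<close>

lemma symmetric_complex_eigenvalue_real:
  fixes A :: "real mat"
  assumes A: "A \<in> carrier_mat n n"
    and sym: "\<And>i j. i < n \<Longrightarrow> j < n \<Longrightarrow> A $$ (i, j) = A $$ (j, i)"
    and root: "poly (char_poly (map_mat complex_of_real A)) l = 0"
  shows "l \<in> \<real>"
proof -
  have cA: "map_mat complex_of_real A \<in> carrier_mat n n" using A by simp
  obtain u where nz: "\<exists>i<n. u i \<noteq> 0"
    and u: "\<And>i. i < n \<Longrightarrow> (\<Sum>j<n. complex_of_real (A $$ (i, j)) * u j) = l * u i"
  proof (rule eigenvector_function[OF cA root])
    fix u assume "\<exists>i<n. u i \<noteq> 0"
      "\<And>i. i < n \<Longrightarrow> (\<Sum>j<n. map_mat complex_of_real A $$ (i, j) * u j) = l * u i"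
    then show ?thesis using A that by (auto intro!: that[of u] simp: carrier_matD)
  qed
  define q where "q = (\<Sum>i<n. \<Sum>j<n. cnj (u i) * complex_of_real (A $$ (i, j)) * u j)"
  define s where "s = (\<Sum>i<n. (cmod (u i))\<^sup>2)"
  have "cnj q = (\<Sum>i<n. \<Sum>j<n. cnj (u j) * complex_of_real (A $$ (i, j)) * u i)"
    by (simp add: q_def mult_ac)
  also have "\<dots> = (\<Sum>j<n. \<Sum>i<n. cnj (u j) * complex_of_real (A $$ (j, i)) * u i)"
    by (subst sum.swap) (intro sum.cong refl, simp add: sym)
  also have "\<dots> = q" by (simp add: q_def)
  finally have "q \<in> \<real>" by (simp add: Reals_cnj_iff)
  moreover have "q = l * of_real s"
  proof -
    have "q = (\<Sum>i<n. cnj (u i) * (l * u i))"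
      by (simp add: q_def u[symmetric] sum_distrib_left mult_ac)
    also have "\<dots> = l * (\<Sum>i<n. u i * cnj (u i))"
      by (simp add: sum_distrib_left mult_ac)
    also have "\<dots> = l * of_real s"
      unfolding s_def of_real_sum complex_norm_square ..
    finally show ?thesis .
  qed
  moreover have "s > 0"
  proof -
    obtain i where "i < n" "u i \<noteq> 0" using nz by blast
    then show ?thesis unfolding s_def by (intro sum_pos2[of _ i]) auto
  qed
  ultimately have "l = q / of_real s" "q \<in> \<real>" by auto
  then show ?thesis by simp
qed

text \<open>
  The complex roots are real, and the coefficients of a real polynomial can be compared after
  embedding it into the complex polynomials.
\<close>

lemma symmetric_char_poly_splits:
  fixes A :: "real mat"
  assumes A: "A \<in> carrier_mat n n"
    and sym: "\<And>i j. i < n \<Longrightarrow> j < n \<Longrightarrow> A $$ (i, j) = A $$ (j, i)"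
  obtains es where "char_poly A = (\<Prod>e\<leftarrow>es. [:- e, 1:])" "length es = n"
proof -
  let ?C = "map_mat complex_of_real A"
  have cA: "?C \<in> carrier_mat n n" using A by simp
  interpret mh: map_poly_inj_idom_hom "of_real :: real \<Rightarrow> complex" ..
  obtain as where as: "char_poly ?C = (\<Prod>a\<leftarrow>as. [:- a, 1:])" "length as = n"
    using char_poly_factorized[OF cA] by blast
  have "a \<in> \<real>" if "a \<in> set as" for a
  proof (rule symmetric_complex_eigenvalue_real[OF A sym])
    show "poly (char_poly ?C) a = 0"
      using that by (force simp: as poly_prod_list prod_list_zero_iff)
  qed
  then have re: "map (\<lambda>a. complex_of_real (Re a)) as = as"
    by (intro map_idI) simp
  have "map_poly complex_of_real (char_poly A) = char_poly ?C"
    by (rule of_real_hom.char_poly_hom[OF A, symmetric])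
  also have "\<dots> = (\<Prod>a\<leftarrow>map (\<lambda>a. complex_of_real (Re a)) as. [:- a, 1:])"
    by (simp only: as re)
  also have "\<dots> = map_poly complex_of_real (\<Prod>e\<leftarrow>map Re as. [:- e, 1:])"
  proof -
    have "map_poly complex_of_real (\<Prod>e\<leftarrow>xs. [:- e, 1:])
      = (\<Prod>e\<leftarrow>xs. [:- complex_of_real e, 1:])" for xs
      by (induction xs) (simp_all add: mh.hom_mult del: mult_pCons_left)
    from this[of "map Re as"] show ?thesis
      by (simp only: map_map o_def)
  qed
  finally have "char_poly A = (\<Prod>e\<leftarrow>map Re as. [:- e, 1:])"
    by (simp only: mh.eq_iff)
  with as(2) show ?thesis by (intro that[of "map Re as"]) auto
qed

definition mat_trace :: "'b :: comm_ring_1 mat \<Rightarrow> 'b" where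
  "mat_trace A = (\<Sum>i<dim_row A. A $$ (i, i))"

lemma mat_trace_mult_commute:
  assumes "A \<in> carrier_mat n m" "B \<in> carrier_mat m n"
  shows "mat_trace (A * B) = mat_trace (B * A)"
proof -
  have "mat_trace (A * B) = (\<Sum>i<n. \<Sum>j<m. A $$ (i, j) * B $$ (j, i))"
    using assms by (simp add: mat_trace_def scalar_prod_def atLeast0LessThan)
  also have "\<dots> = (\<Sum>j<m. \<Sum>i<n. B $$ (j, i) * A $$ (i, j))"
    by (subst sum.swap) (simp add: mult.commute)
  also have "\<dots> = mat_trace (B * A)"
    using assms by (simp add: mat_trace_def scalar_prod_def atLeast0LessThan)
  finally show ?thesis .
qed

lemma upper_triangular_mult:
  fixes A B :: "'b :: comm_ring_1 mat"
  assumes A: "A \<in> carrier_mat n n" "upper_triangular A"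
    and B: "B \<in> carrier_mat n n" "upper_triangular B"
  shows "upper_triangular (A * B)"
    and "\<And>i. i < n \<Longrightarrow> (A * B) $$ (i, i) = A $$ (i, i) * B $$ (i, i)"
proof -
  have entry: "(A * B) $$ (i, j) = (\<Sum>k<n. A $$ (i, k) * B $$ (k, j))" if "i < n" "j < n" for i j
    using that A(1) B(1) by (simp add: scalar_prod_def atLeast0LessThan)
  show "upper_triangular (A * B)"
  proof (rule upper_triangularI)
    fix i j assume ij: "j < i" "i < dim_row (A * B)"
    then have n: "i < n" "j < n" using A(1) by auto
    have "A $$ (i, k) * B $$ (k, j) = 0" if "k < n" for k
    proof (cases "k < i")
      case True
      then show ?thesis using upper_triangularD[OF A(2), of k i] A(1) n by simp
    next
      case False
      then show ?thesis using upper_triangularD[OF B(2), of j k] B(1) n ij that by simp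
    qed
    then show "(A * B) $$ (i, j) = 0" by (simp add: entry[OF n])
  qed
  fix i assume i: "i < n"
  have "A $$ (i, k) * B $$ (k, i) = (if k = i then A $$ (i, i) * B $$ (i, i) else 0)"
    if "k < n" for k
  proof (cases k i rule: linorder_cases)
    case less
    then show ?thesis using upper_triangularD[OF A(2), of k i] A(1) i by simp
  next
    case greater
    then show ?thesis using upper_triangularD[OF B(2), of i k] B(1) that by simp
  qed simp
  then have "(A * B) $$ (i, i) = (\<Sum>k<n. if k = i then A $$ (i, i) * B $$ (i, i) else 0)"
    unfolding entry[OF i i] by (intro sum.cong) auto
  also have "\<dots> = A $$ (i, i) * B $$ (i, i)" using i by (subst sum.delta) auto
  finally show "(A * B) $$ (i, i) = A $$ (i, i) * B $$ (i, i)" .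
qed

lemma upper_triangular_pow:
  fixes A :: "'b :: comm_ring_1 mat"
  assumes A: "A \<in> carrier_mat n n" "upper_triangular A"
  shows "upper_triangular (A ^\<^sub>m k) \<and> (\<forall>i<n. (A ^\<^sub>m k) $$ (i, i) = (A $$ (i, i)) ^ k)"
proof (induction k)
  case 0
  show ?case using A(1) by (auto intro!: upper_triangularI)
next
  case (Suc k)
  have "A ^\<^sub>m k \<in> carrier_mat n n" using A(1) by simp
  with Suc upper_triangular_mult[of "A ^\<^sub>m k" n A] A show ?case by (simp add: mult.commute)
qed

text \<open>
  The Schur decomposition makes the matrix triangular, and a power of a triangular matrix has
  the powers of the eigenvalues on its diagonal.
\<close>

lemma symmetric_eigenvalues_power_sum:
  fixes A :: "real mat"
  assumes A: "A \<in> carrier_mat n n"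
    and sym: "\<And>i j. i < n \<Longrightarrow> j < n \<Longrightarrow> A $$ (i, j) = A $$ (j, i)"
  shows "(\<Sum>l\<in>#eigenvalues A. l ^ k) = mat_trace (A ^\<^sub>m k)"
proof -
  obtain es where es: "char_poly A = (\<Prod>e\<leftarrow>es. [:- e, 1:])" "length es = n"
    using symmetric_char_poly_splits[OF A sym] by blast
  obtain B P Q where sch: "schur_decomposition A es = (B, P, Q)"
    by (cases "schur_decomposition A es") auto
  from schur_decomposition[OF A es(1) sch]
  have sim: "similar_mat_wit A B P Q" and up: "upper_triangular B" and diag: "diag_mat B = es"
    by blast+
  from similar_mat_witD2[OF A sim]
  have B: "B \<in> carrier_mat n n" and P: "P \<in> carrier_mat n n" and Q: "Q \<in> carrier_mat n n"
    by blast+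
  have "similar_mat_wit (A ^\<^sub>m k) (B ^\<^sub>m k) P Q" by (rule similar_mat_wit_pow[OF sim])
  from similar_mat_witD2[OF pow_carrier_mat[OF A] this]
  have eq: "A ^\<^sub>m k = P * B ^\<^sub>m k * Q" and QP: "Q * P = 1\<^sub>m n"
    by blast+
  have Bk: "B ^\<^sub>m k \<in> carrier_mat n n" using B by simp
  have "mat_trace (A ^\<^sub>m k) = mat_trace (Q * (P * B ^\<^sub>m k))"
    unfolding eq by (rule mat_trace_mult_commute) (use P Bk Q in auto)
  also have "Q * (P * B ^\<^sub>m k) = B ^\<^sub>m k"
    by (simp add: QP left_mult_one_mat[OF Bk] flip: assoc_mult_mat[OF Q P Bk])
  also have "mat_trace (B ^\<^sub>m k) = (\<Sum>i<n. (B $$ (i, i)) ^ k)"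
    using upper_triangular_pow[OF B up, of k] B by (simp add: mat_trace_def)
  also have "\<dots> = (\<Sum>e\<leftarrow>es. e ^ k)"
    using B by (simp add: diag[symmetric] diag_mat_def sum_list_sum_nth atLeast0LessThan)
  also have "\<dots> = (\<Sum>l\<in>#mset es. l ^ k)"
    by (simp only: sum_mset_sum_list flip: mset_map)
  also have "mset es = eigenvalues A"
  proof -
    have "(\<Prod>e\<leftarrow>es. [:- e, 1:]) \<noteq> 0" for es :: "real list"
      by (induction es) (simp_all del: mult_pCons_left)
    then have "proots (\<Prod>e\<leftarrow>es. [:- e, 1:]) = mset es"
      by (induction es) (simp_all add: proots_mult del: mult_pCons_left)
    then show ?thesis by (simp add: eigenvalues_def es(1))
  qed
  finally show ?thesis by simp
qed

section \<open>The ring of row-finite kernels\<close>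

text \<open>
  Square matrices with arbitrary index type and finitely supported rows form a unital ring, so that the
  algebra of type classes is available although the complexes, which serve as index sets, vary.
\<close>

typedef 'v kernel = "{K :: 'v \<Rightarrow> 'v \<Rightarrow> real. \<forall>x. finite {y. K x y \<noteq> 0}}"
  morphisms entry Kernel
  by (rule exI[of _ "\<lambda>_ _. 0"]) simp

setup_lifting type_definition_kernel

lemma finite_row [simp]: "finite {y. entry K x y \<noteq> 0}"
  using entry[of K] by simp

lemma kernel_eqI: "(\<And>x y. entry A x y = entry B x y) \<Longrightarrow> A = B"
  by (simp add: entry_inject[symmetric] fun_eq_iff)

lemma finite_row_mult:
  fixes A B :: "'v \<Rightarrow> 'v \<Rightarrow> real"
  assumes "\<And>x. finite {y. A x y \<noteq> 0}" "\<And>x. finite {y. B x y \<noteq> 0}"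
  shows "finite {y. (\<Sum>z | A x z \<noteq> 0. A x z * B z y) \<noteq> 0}"
proof (rule finite_subset)
  show "{y. (\<Sum>z | A x z \<noteq> 0. A x z * B z y) \<noteq> 0} \<subseteq> (\<Union>z\<in>{z. A x z \<noteq> 0}. {y. B z y \<noteq> 0})"
  proof
    fix y assume "y \<in> {y. (\<Sum>z | A x z \<noteq> 0. A x z * B z y) \<noteq> 0}"
    then obtain z where "z \<in> {z. A x z \<noteq> 0}" "A x z * B z y \<noteq> 0"
      by (metis (mono_tags, lifting) mem_Collect_eq sum.neutral)
    then show "y \<in> (\<Union>z\<in>{z. A x z \<noteq> 0}. {y. B z y \<noteq> 0})" by auto
  qed
qed (use assms in auto)

instantiation kernel :: (type) ring_1
begin

lift_definition zero_kernel :: "'a kernel" is "\<lambda>_ _. 0" by simp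

lift_definition one_kernel :: "'a kernel" is "\<lambda>x y. of_bool (x = y)" by simp

lift_definition plus_kernel :: "'a kernel \<Rightarrow> 'a kernel \<Rightarrow> 'a kernel"
  is "\<lambda>A B x y. A x y + B x y"
proof -
  fix A B :: "'a \<Rightarrow> 'a \<Rightarrow> real" and x
  assume fin: "\<And>x. finite {y. A x y \<noteq> 0}" "\<And>x. finite {y. B x y \<noteq> 0}"
  have "{y. A x y + B x y \<noteq> 0} \<subseteq> {y. A x y \<noteq> 0} \<union> {y. B x y \<noteq> 0}"
    by auto
  then show "finite {y. A x y + B x y \<noteq> 0}"
    by (rule finite_subset) (rule finite_UnI[OF fin(1) fin(2)])
qed

lift_definition uminus_kernel :: "'a kernel \<Rightarrow> 'a kernel" is "\<lambda>A x y. - A x y" by simp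

definition minus_kernel :: "'a kernel \<Rightarrow> 'a kernel \<Rightarrow> 'a kernel" where
  "minus_kernel A B = A + - B"

lift_definition times_kernel :: "'a kernel \<Rightarrow> 'a kernel \<Rightarrow> 'a kernel"
  is "\<lambda>A B x y. \<Sum>z | A x z \<noteq> 0. A x z * B z y"
  by (simp add: finite_row_mult)

lemma entry_times:
  assumes "finite Z" "\<And>z. entry A x z \<noteq> 0 \<Longrightarrow> z \<in> Z"
  shows "entry (A * B) x y = (\<Sum>z\<in>Z. entry A x z * entry B z y)"
  unfolding times_kernel.rep_eq by (rule sum.mono_neutral_left) (use assms in auto)

instance
proof
  fix A B C :: "'a kernel"
  show "A * B * C = A * (B * C)"
  proof (rule kernel_eqI)
    fix x y
    define Z where "Z = {z. entry A x z \<noteq> 0}"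
    define W where "W = (\<Union>z\<in>Z. {w. entry B z w \<noteq> 0})"
    have fin: "finite Z" "finite W" by (auto simp: Z_def W_def)
    have AB: "entry (A * B) x w = (\<Sum>z\<in>Z. entry A x z * entry B z w)" for w
      by (rule entry_times) (use fin in \<open>auto simp: Z_def\<close>)
    have "w \<in> W" if "entry (A * B) x w \<noteq> 0" for w
    proof -
      from that obtain z where "z \<in> Z" "entry A x z * entry B z w \<noteq> 0"
        unfolding AB by (meson sum.neutral)
      then show ?thesis by (auto simp: W_def)
    qed
    then have "entry (A * B * C) x y = (\<Sum>w\<in>W. \<Sum>z\<in>Z. entry A x z * entry B z w * entry C w y)"
      by (subst entry_times[OF fin(2)]) (auto simp: AB sum_distrib_right)
    also have "\<dots> = (\<Sum>z\<in>Z. entry A x z * (\<Sum>w\<in>W. entry B z w * entry C w y))"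
      by (subst sum.swap) (simp add: sum_distrib_left mult.assoc)
    also have "\<dots> = (\<Sum>z\<in>Z. entry A x z * entry (B * C) z y)"
      by (intro sum.cong refl arg_cong2[where f = "(*)"] entry_times[symmetric])
         (use fin in \<open>auto simp: W_def\<close>)
    also have "\<dots> = entry (A * (B * C)) x y"
      by (rule entry_times[symmetric]) (use fin in \<open>auto simp: Z_def\<close>)
    finally show "entry (A * B * C) x y = entry (A * (B * C)) x y" .
  qed
  show "1 * A = A"
    by (rule kernel_eqI, subst entry_times[of "{x}" for x]) (auto simp: one_kernel.rep_eq)
  show "A * 1 = A"
  proof (rule kernel_eqI)
    fix x y
    show "entry (A * 1) x y = entry A x y"
      by (subst entry_times[of "insert y {z. entry A x z \<noteq> 0}"])
         (auto simp: one_kernel.rep_eq sum.delta of_bool_def if_distrib cong: if_cong)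
  qed
  show "(A + B) * C = A * C + B * C"
  proof (rule kernel_eqI)
    fix x y
    let ?Z = "{z. entry A x z \<noteq> 0} \<union> {z. entry B x z \<noteq> 0}"
    have "entry ((A + B) * C) x y = (\<Sum>z\<in>?Z. entry (A + B) x z * entry C z y)"
      by (rule entry_times) (auto simp: plus_kernel.rep_eq)
    moreover have "entry (A * C) x y = (\<Sum>z\<in>?Z. entry A x z * entry C z y)"
      and "entry (B * C) x y = (\<Sum>z\<in>?Z. entry B x z * entry C z y)"
      by (rule entry_times; auto)+
    ultimately show "entry ((A + B) * C) x y = entry (A * C + B * C) x y"
      by (simp add: plus_kernel.rep_eq distrib_right sum.distrib)
  qed
  show "A * (B + C) = A * B + A * C"
    by (rule kernel_eqI)
       (simp add: times_kernel.rep_eq plus_kernel.rep_eq distrib_left sum.distrib)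
  show "(0 :: 'a kernel) \<noteq> 1"
    by (simp add: entry_inject[symmetric] fun_eq_iff one_kernel.rep_eq zero_kernel.rep_eq)
  show "A - B = A + - B" by (simp add: minus_kernel_def)
qed (transfer; simp add: fun_eq_iff algebra_simps)+

end

lemma entry_simps [simp]:
  "entry 0 x y = 0"
  "entry 1 x y = of_bool (x = y)"
  "entry (A + B) x y = entry A x y + entry B x y"
  "entry (- A) x y = - entry A x y"
  "entry (A - B) x y = entry A x y - entry B x y"
  by (simp_all only: zero_kernel.rep_eq one_kernel.rep_eq plus_kernel.rep_eq uminus_kernel.rep_eq
      minus_kernel_def diff_conv_add_uminus)

lift_definition kernel_on :: "'v set \<Rightarrow> ('v \<Rightarrow> 'v \<Rightarrow> real) \<Rightarrow> 'v kernel"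
  is "\<lambda>X f x y. if finite X \<and> x \<in> X \<and> y \<in> X then f x y else 0"
proof -
  fix X :: "'v set" and f :: "'v \<Rightarrow> 'v \<Rightarrow> real" and x
  show "finite {y. (if finite X \<and> x \<in> X \<and> y \<in> X then f x y else 0) \<noteq> 0}"
  proof (cases "finite X")
    case True
    then show ?thesis by (rule rev_finite_subset) auto
  next
    case False
    then show ?thesis by simp
  qed
qed

lemma entry_kernel_on [simp]:
  "finite X \<Longrightarrow> entry (kernel_on X f) x y = (if x \<in> X \<and> y \<in> X then f x y else 0)"
  by transfer simp

text \<open>
  Kernels that do not connect \<open>X\<close> to its complement: on these, restriction to \<open>X\<close> is a ring
  homomorphism to the matrices indexed by \<open>X\<close>. The unit of the ring is among them, which a
  support condition would exclude.
\<close>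

definition block :: "'v set \<Rightarrow> 'v kernel \<Rightarrow> bool" where
  "block X A \<longleftrightarrow> (\<forall>x y. entry A x y \<noteq> 0 \<longrightarrow> (x \<in> X \<longleftrightarrow> y \<in> X))"

lemma blockD: "block X A \<Longrightarrow> entry A x y \<noteq> 0 \<Longrightarrow> x \<in> X \<longleftrightarrow> y \<in> X"
  by (simp add: block_def)

lemma block_add [simp]: "block X A \<Longrightarrow> block X B \<Longrightarrow> block X (A + B)"
  unfolding block_def by (metis add_0 entry_simps(3))

lemma block_uminus [simp]: "block X A \<Longrightarrow> block X (- A)"
  by (simp add: block_def)

lemma block_diff [simp]: "block X A \<Longrightarrow> block X B \<Longrightarrow> block X (A - B)"
  using block_add[of X A "- B"] by simp

lemma block_one [simp]: "block X 1" and block_zero [simp]: "block X 0"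
  by (auto simp: block_def)

lemma block_two [simp]: "block X 2"
  using block_add[of X 1 1] by simp

lemma block_mult [simp]:
  assumes "block X A" "block X B"
  shows "block X (A * B)"
  unfolding block_def
proof (intro allI impI)
  fix x y assume "entry (A * B) x y \<noteq> 0"
  then obtain z where "entry A x z * entry B z y \<noteq> 0"
    unfolding times_kernel.rep_eq by (meson sum.neutral)
  then show "x \<in> X \<longleftrightarrow> y \<in> X" using blockD[OF assms(1)] blockD[OF assms(2)] by auto
qed

lemma block_power [simp]: "block X A \<Longrightarrow> block X (A ^ k)"
  by (induction k) simp_all

lemma block_kernel_on [simp]: "finite Y \<Longrightarrow> Y \<subseteq> X \<Longrightarrow> block X (kernel_on Y f)"
  by (auto simp: block_def)

lemma entry_mult_block:
  assumes "finite X" "block X A" "x \<in> X"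
  shows "entry (A * B) x y = (\<Sum>z\<in>X. entry A x z * entry B z y)"
  by (rule entry_times) (use assms blockD[OF assms(2)] in auto)

definition trace_on :: "'v set \<Rightarrow> 'v kernel \<Rightarrow> real" where
  "trace_on X A = (\<Sum>x\<in>X. entry A x x)"

lemma trace_on_simps [simp]:
  "trace_on X (A + B) = trace_on X A + trace_on X B"
  "trace_on X (A - B) = trace_on X A - trace_on X B"
  "trace_on X (- A) = - trace_on X A"
  "trace_on X 1 = card X"
  "trace_on X 0 = 0"
  by (simp_all add: trace_on_def sum.distrib sum_subtractf sum_negf)

lemma trace_on_commute:
  assumes "finite X" "block X A" "block X B"
  shows "trace_on X (A * B) = trace_on X (B * A)"
  unfolding trace_on_def
  by (simp add: entry_mult_block[OF assms(1)] assms(2,3), subst sum.swap, simp add: mult.commute)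

definition l1_norm_on :: "'v set \<Rightarrow> 'v kernel \<Rightarrow> real" where
  "l1_norm_on X A = (\<Sum>x\<in>X. \<Sum>y\<in>X. \<bar>entry A x y\<bar>)"

definition row_bounded :: "'v set \<Rightarrow> real \<Rightarrow> 'v kernel \<Rightarrow> bool" where
  "row_bounded X M A \<longleftrightarrow> (\<forall>x\<in>X. (\<Sum>y\<in>X. \<bar>entry A x y\<bar>) \<le> M)"

lemma row_boundedD: "row_bounded X M A \<Longrightarrow> x \<in> X \<Longrightarrow> (\<Sum>y\<in>X. \<bar>entry A x y\<bar>) \<le> M"
  by (simp add: row_bounded_def)

lemma row_bounded_mono: "row_bounded X M A \<Longrightarrow> M \<le> M' \<Longrightarrow> row_bounded X M' A"
  unfolding row_bounded_def by force

lemma row_bounded_add: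
  assumes "row_bounded X M A" "row_bounded X M' B"
  shows "row_bounded X (M + M') (A + B)"
  unfolding row_bounded_def
proof
  fix x assume "x \<in> X"
  have "(\<Sum>y\<in>X. \<bar>entry (A + B) x y\<bar>) \<le> (\<Sum>y\<in>X. \<bar>entry A x y\<bar> + \<bar>entry B x y\<bar>)"
    by (intro sum_mono) simp
  also have "\<dots> \<le> M + M'"
    using assms \<open>x \<in> X\<close> by (simp add: row_bounded_def sum.distrib add_mono)
  finally show "(\<Sum>y\<in>X. \<bar>entry (A + B) x y\<bar>) \<le> M + M'" .
qed

lemma row_bounded_uminus [simp]: "row_bounded X M (- A) \<longleftrightarrow> row_bounded X M A"
  by (simp add: row_bounded_def)

lemma row_bounded_diff:
  "row_bounded X M A \<Longrightarrow> row_bounded X M' B \<Longrightarrow> row_bounded X (M + M') (A - B)"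
  using row_bounded_add[of X M A M' "- B"] by simp

lemma row_sum_mult_le:
  assumes X: "finite X" "block X A" and B: "row_bounded X M' B" and x: "x \<in> X"
  shows "(\<Sum>y\<in>X. \<bar>entry (A * B) x y\<bar>) \<le> (\<Sum>z\<in>X. \<bar>entry A x z\<bar>) * M'"
proof -
  have "(\<Sum>y\<in>X. \<bar>entry (A * B) x y\<bar>) \<le> (\<Sum>y\<in>X. \<Sum>z\<in>X. \<bar>entry A x z\<bar> * \<bar>entry B z y\<bar>)"
    unfolding entry_mult_block[OF X x] abs_mult[symmetric] by (intro sum_mono sum_abs)
  also have "\<dots> = (\<Sum>z\<in>X. \<bar>entry A x z\<bar> * (\<Sum>y\<in>X. \<bar>entry B z y\<bar>))"
    by (subst sum.swap) (simp add: sum_distrib_left)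
  also have "\<dots> \<le> (\<Sum>z\<in>X. \<bar>entry A x z\<bar> * M')"
    by (intro sum_mono mult_left_mono row_boundedD[OF B]) auto
  finally show ?thesis by (simp add: sum_distrib_right)
qed

lemma row_bounded_mult:
  assumes X: "finite X" "block X A" and A: "row_bounded X M A" and B: "row_bounded X M' B" "0 \<le> M'"
  shows "row_bounded X (M * M') (A * B)"
  unfolding row_bounded_def
proof
  fix x assume x: "x \<in> X"
  have "(\<Sum>y\<in>X. \<bar>entry (A * B) x y\<bar>) \<le> (\<Sum>z\<in>X. \<bar>entry A x z\<bar>) * M'"
    by (rule row_sum_mult_le[OF X B(1) x])
  also have "\<dots> \<le> M * M'" by (intro mult_right_mono row_boundedD[OF A x] B(2))
  finally show "(\<Sum>y\<in>X. \<bar>entry (A * B) x y\<bar>) \<le> M * M'" .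
qed

lemma l1_norm_on_triangle: "l1_norm_on X (A + B) \<le> l1_norm_on X A + l1_norm_on X B"
  unfolding l1_norm_on_def sum.distrib[symmetric] by (intro sum_mono) simp

lemma abs_trace_on_le:
  assumes "finite X" shows "\<bar>trace_on X A\<bar> \<le> l1_norm_on X A"
proof -
  have "\<bar>trace_on X A\<bar> \<le> (\<Sum>x\<in>X. \<bar>entry A x x\<bar>)" unfolding trace_on_def by (rule sum_abs)
  also have "\<dots> \<le> l1_norm_on X A"
    unfolding l1_norm_on_def
    by (intro sum_mono member_le_sum) (use assms in auto)
  finally show ?thesis .
qed

lemma l1_norm_on_mult_right:
  assumes "finite X" "block X A" "row_bounded X M B"
  shows "l1_norm_on X (A * B) \<le> l1_norm_on X A * M"
proof -
  have "l1_norm_on X (A * B) \<le> (\<Sum>x\<in>X. (\<Sum>z\<in>X. \<bar>entry A x z\<bar>) * M)"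
    unfolding l1_norm_on_def by (rule sum_mono) (rule row_sum_mult_le[OF assms])
  then show ?thesis by (simp only: l1_norm_on_def sum_distrib_right)
qed

lemma l1_norm_on_mult_left:
  assumes X: "finite X" "block X A"
    and A: "row_bounded X M A" "\<And>x y. entry A x y = entry A y x"
  shows "l1_norm_on X (A * B) \<le> M * l1_norm_on X B"
proof -
  have "l1_norm_on X (A * B) \<le> (\<Sum>x\<in>X. \<Sum>y\<in>X. \<Sum>z\<in>X. \<bar>entry A z x\<bar> * \<bar>entry B z y\<bar>)"
    unfolding l1_norm_on_def abs_mult[symmetric]
  proof (intro sum_mono)
    fix x y assume "x \<in> X" "y \<in> X"
    then show "\<bar>entry (A * B) x y\<bar> \<le> (\<Sum>z\<in>X. \<bar>entry A z x * entry B z y\<bar>)"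
      using sum_abs[of "\<lambda>z. entry A x z * entry B z y" X]
      by (simp add: entry_mult_block[OF X] A(2)[of _ x])
  qed
  also have "\<dots> = (\<Sum>x\<in>X. \<Sum>z\<in>X. \<Sum>y\<in>X. \<bar>entry A z x\<bar> * \<bar>entry B z y\<bar>)"
    by (intro sum.cong refl sum.swap)
  also have "\<dots> = (\<Sum>z\<in>X. \<Sum>x\<in>X. \<Sum>y\<in>X. \<bar>entry A z x\<bar> * \<bar>entry B z y\<bar>)"
    by (rule sum.swap)
  also have "\<dots> = (\<Sum>z\<in>X. (\<Sum>x\<in>X. \<bar>entry A z x\<bar>) * (\<Sum>y\<in>X. \<bar>entry B z y\<bar>))"
    by (simp only: sum_product)
  also have "\<dots> \<le> (\<Sum>z\<in>X. M * (\<Sum>y\<in>X. \<bar>entry B z y\<bar>))"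
    by (intro sum_mono mult_right_mono row_boundedD[OF A(1)] sum_nonneg) auto
  finally show ?thesis by (simp add: l1_norm_on_def sum_distrib_left)
qed

text \<open>
  This bounds the change of the trace of a power under a perturbation of small entrywise sum,
  whatever the size of \<open>X\<close>. It comes from
  \<open>A\<^sup>k\<^sup>+\<^sup>2 - B\<^sup>k\<^sup>+\<^sup>2 = (A - B) B\<^sup>k\<^sup>+\<^sup>1 + A (A\<^sup>k\<^sup>+\<^sup>1 - B\<^sup>k\<^sup>+\<^sup>1)\<close>; multiplication on the left needs
  bounds on column sums, which symmetry of \<open>A\<close> provides.
\<close>

lemma l1_norm_on_power_diff:
  assumes X: "finite X" "block X A" "block X B"
    and A: "row_bounded X M A" "\<And>x y. entry A x y = entry A y x"
    and B: "row_bounded X M B" and M: "0 \<le> M"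
  shows "l1_norm_on X (A ^ Suc k - B ^ Suc k) \<le> real (Suc k) * M ^ k * l1_norm_on X (A - B)"
proof (induction k)
  case 0
  show ?case by simp
next
  case (Suc k)
  have pow: "l1_norm_on X ((A - B) * B ^ m) \<le> l1_norm_on X (A - B) * M ^ m" for m
  proof (induction m)
    case (Suc m)
    have "l1_norm_on X ((A - B) * B ^ m * B) \<le> l1_norm_on X ((A - B) * B ^ m) * M"
      by (rule l1_norm_on_mult_right) (use X B in auto)
    also have "\<dots> \<le> l1_norm_on X (A - B) * M ^ m * M"
      by (intro mult_right_mono Suc.IH M)
    finally show ?case by (simp only: power_Suc2 mult.assoc)
  qed simp
  have "A ^ Suc (Suc k) - B ^ Suc (Suc k) = (A - B) * B ^ Suc k + A * (A ^ Suc k - B ^ Suc k)"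
    by (simp add: algebra_simps)
  then have "l1_norm_on X (A ^ Suc (Suc k) - B ^ Suc (Suc k))
      \<le> l1_norm_on X ((A - B) * B ^ Suc k) + l1_norm_on X (A * (A ^ Suc k - B ^ Suc k))"
    by (metis l1_norm_on_triangle)
  also have "\<dots> \<le> l1_norm_on X (A - B) * M ^ Suc k + M * (real (Suc k) * M ^ k * l1_norm_on X (A - B))"
  proof (intro add_mono pow order.trans[OF l1_norm_on_mult_left[OF X(1,2) A]] mult_left_mono Suc.IH M)
  qed
  finally show ?case by (simp add: algebra_simps)
qed

section \<open>Graphs as complexes: incidence and connection\<close>

abbreviation comparable :: "'v set \<Rightarrow> 'v set \<Rightarrow> bool" where
  "comparable x y \<equiv> x \<subset> y \<or> y \<subset> x"

definition vertices :: "'v set set \<Rightarrow> 'v set set" where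
  "vertices G = {x\<in>G. card x = 1}"

definition edges :: "'v set set \<Rightarrow> 'v set set" where
  "edges G = {x\<in>G. card x = 2}"

text \<open>
  For a vertex of a graph this is its degree; for an edge it is 2.
\<close>

definition incidences :: "'v set set \<Rightarrow> 'v set \<Rightarrow> nat" where
  "incidences G x = card {y\<in>G. comparable x y}"

definition projection :: "'v set \<Rightarrow> 'v kernel" where
  "projection X = kernel_on X (\<lambda>x y. of_bool (x = y))"

text \<open>
  The adjacency of the graph whose Whitney complex is the barycentric refinement. It is the
  signless Dirac operator: the sum of the unsigned incidence matrix and its transpose.
\<close>

definition hasse :: "'v set set \<Rightarrow> 'v set kernel" where
  "hasse G = kernel_on G (\<lambda>x y. of_bool (comparable x y))"

definition connection :: "'v set set \<Rightarrow> 'v set kernel" where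
  "connection G = kernel_on G (\<lambda>x y. of_bool (x \<inter> y \<noteq> {}))"

lemma finite_card_2_subsets:
  assumes "card e = 2" "v \<subset> e" "v \<noteq> {}"
  shows "card v = 1"
proof -
  have "finite e" using assms(1) by (simp add: card_ge_0_finite)
  then show ?thesis
    using psubset_card_mono[of e v] assms card_gt_0_iff[of v] finite_subset[of v e] by fastforce
qed

locale graph_complex =
  fixes G :: "'v set set"
  assumes complex: "finite_simplicial_complex G"
    and dim: "x \<in> G \<Longrightarrow> card x \<le> 2"
begin

lemma finite_G [simp]: "finite G"
  using complex by (simp add: finite_simplicial_complex_def)

lemma simplex_finite: "x \<in> G \<Longrightarrow> finite x"
  using complex by (simp add: finite_simplicial_complex_def)

lemma simplex_nonempty: "x \<in> G \<Longrightarrow> x \<noteq> {}"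
  using complex by (simp add: finite_simplicial_complex_def)

lemma face: "x \<in> G \<Longrightarrow> y \<subseteq> x \<Longrightarrow> y \<noteq> {} \<Longrightarrow> y \<in> G"
  using complex unfolding finite_simplicial_complex_def by blast

lemma card_cases: "x \<in> G \<Longrightarrow> card x = 1 \<or> card x = 2"
proof -
  assume x: "x \<in> G"
  then have "card x > 0" using simplex_finite simplex_nonempty by (simp add: card_gt_0_iff)
  with dim[OF x] show ?thesis by linarith
qed

lemma G_split: "G = vertices G \<union> edges G" "vertices G \<inter> edges G = {}"
  using card_cases by (auto simp: vertices_def edges_def)

lemma finite_vertices [simp]: "finite (vertices G)" and finite_edges [simp]: "finite (edges G)"
  by (auto simp: vertices_def edges_def)

lemma psubset_cards:
  assumes "x \<in> G" "y \<in> G" "x \<subset> y"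
  shows "card x = 1" "card y = 2"
  using psubset_card_mono[OF simplex_finite[OF assms(2)] assms(3)] card_cases[OF assms(1)]
    card_cases[OF assms(2)] by auto

lemma card_faces:
  assumes "card y = 2" "y \<in> G"
  shows "card {x\<in>G. x \<subset> y} = 2"
proof -
  obtain a b where ab: "y = {a, b}" "a \<noteq> b" using assms(1) by (auto simp: card_2_iff)
  have "{x\<in>G. x \<subset> y} = {{a}, {b}}"
    using face[OF assms(2)] ab simplex_nonempty by auto
  then show ?thesis using ab by simp
qed

lemma incidences_edge:
  assumes "y \<in> edges G"
  shows "incidences G y = 2"
proof -
  have "{x\<in>G. comparable y x} = {x\<in>G. x \<subset> y}"
    using assms psubset_cards(1)[of y] by (auto simp: edges_def)
  then show ?thesis using card_faces[of y] assms by (simp add: incidences_def edges_def)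
qed

lemma block_complex [simp]:
  "block G (hasse G)" "block G (connection G)"
  "X \<subseteq> G \<Longrightarrow> block G (projection X)"
  by (simp_all add: hasse_def connection_def projection_def finite_subset)

abbreviation "PV \<equiv> projection (vertices G)"
abbreviation "PE \<equiv> projection (edges G)"
abbreviation "N \<equiv> hasse G"

lemma entry_projection [simp]:
  "entry PV x y = of_bool (x = y \<and> x \<in> vertices G)"
  "entry PE x y = of_bool (x = y \<and> x \<in> edges G)"
  "entry (projection G) x y = of_bool (x = y \<and> x \<in> G)"
  by (auto simp: projection_def)

lemma entry_hasse: "entry N x y = of_bool (x \<in> G \<and> y \<in> G \<and> comparable x y)"
  by (auto simp: hasse_def)

lemma entry_projection_mult:
  "entry (PV * A) x y = of_bool (x \<in> vertices G) * entry A x y"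
  "entry (PE * A) x y = of_bool (x \<in> edges G) * entry A x y"
  by (subst entry_times[of "{x}"]; simp)+

lemma entry_mult_projection:
  assumes "\<And>x y. entry A x y \<noteq> 0 \<Longrightarrow> x \<in> G \<and> y \<in> G"
  shows "entry (A * PV) x y = of_bool (y \<in> vertices G) * entry A x y"
    "entry (A * PE) x y = of_bool (y \<in> edges G) * entry A x y"
proof -
  have "entry (A * B) x y = (\<Sum>z\<in>G. entry A x z * entry B z y)" for B
    by (rule entry_times) (use assms in auto)
  moreover have "(\<Sum>z\<in>G. entry A x z * of_bool (z = y \<and> z \<in> X)) = of_bool (y \<in> X) * entry A x y"
    if "X \<subseteq> G" for X
  proof -
    have "(\<Sum>z\<in>G. entry A x z * of_bool (z = y \<and> z \<in> X))
        = (\<Sum>z\<in>G. if z = y then of_bool (y \<in> X) * entry A x y else 0)"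
      by (intro sum.cong) auto
    also have "\<dots> = of_bool (y \<in> X) * entry A x y" using that by auto
    finally show ?thesis .
  qed
  moreover have "vertices G \<subseteq> G" "edges G \<subseteq> G" by (auto simp: vertices_def edges_def)
  ultimately show "entry (A * PV) x y = of_bool (y \<in> vertices G) * entry A x y"
    "entry (A * PE) x y = of_bool (y \<in> edges G) * entry A x y" by auto
qed

lemma projection_mult:
  "PV * PV = PV" "PE * PE = PE" "PV * PE = 0" "PE * PV = 0"
  using G_split(2) by (auto intro!: kernel_eqI simp: entry_projection_mult)

lemma PV_plus_PE: "PV + PE = projection G"
  using G_split by (auto intro!: kernel_eqI simp: of_bool_def)

lemma entry_hasse_projection:
  "entry (N * PV) x y = of_bool (y \<in> vertices G) * entry N x y"
  "entry (N * PE) x y = of_bool (y \<in> edges G) * entry N x y"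
  by (rule entry_mult_projection; simp add: entry_hasse)+

lemma vertices_iff: "x \<in> vertices G \<longleftrightarrow> x \<in> G \<and> card x = 1"
  and edges_iff: "x \<in> edges G \<longleftrightarrow> x \<in> G \<and> card x = 2"
  by (simp_all add: vertices_def edges_def)

text \<open>
  Strict inclusion in a graph only occurs between a vertex and an edge, which makes the Hasse
  diagram bipartite.
\<close>

lemma comparable_cards:
  assumes "x \<in> G" "y \<in> G" "comparable x y"
  shows "card x = 1 \<longleftrightarrow> card y = 2" "card x = 2 \<longleftrightarrow> card y = 1"
proof -
  have "card x = 1 \<and> card y = 2 \<or> card x = 2 \<and> card y = 1"
    using assms psubset_cards by blast
  then show "card x = 1 \<longleftrightarrow> card y = 2" "card x = 2 \<longleftrightarrow> card y = 1" by auto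
qed

lemma PV_hasse: "PV * N = N * PE"
proof (rule kernel_eqI)
  fix x y
  show "entry (PV * N) x y = entry (N * PE) x y"
  proof (cases "x \<in> G \<and> y \<in> G \<and> comparable x y")
    case True
    then show ?thesis
      using comparable_cards[of x y]
      by (simp add: entry_projection_mult entry_hasse_projection entry_hasse vertices_iff edges_iff)
  qed (simp add: entry_projection_mult entry_hasse_projection entry_hasse)
qed

lemma PE_hasse: "PE * N = N * PV"
proof (rule kernel_eqI)
  fix x y
  show "entry (PE * N) x y = entry (N * PV) x y"
  proof (cases "x \<in> G \<and> y \<in> G \<and> comparable x y")
    case True
    then show ?thesis
      using comparable_cards[of x y]
      by (simp add: entry_projection_mult entry_hasse_projection entry_hasse vertices_iff edges_iff)
  qed (simp add: entry_projection_mult entry_hasse_projection entry_hasse)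
qed

lemma hasse_split: "N = N * PV + N * PE"
proof (rule kernel_eqI)
  fix x y
  show "entry N x y = entry (N * PV + N * PE) x y"
    using card_cases[of y]
    by (cases "y \<in> G") (auto simp: entry_hasse_projection entry_hasse vertices_iff edges_iff)
qed

lemma entry_hasse_square:
  assumes "x \<in> G"
  shows "entry (N * N) x y = card {z\<in>G. comparable x z \<and> comparable z y \<and> y \<in> G}"
proof -
  have "entry (N * N) x y = (\<Sum>z\<in>G. entry N x z * entry N z y)"
    by (rule entry_mult_block) (simp_all add: assms)
  also have "\<dots> = (\<Sum>z\<in>G. if comparable x z \<and> comparable z y \<and> y \<in> G then 1 else 0)"
  proof (rule sum.cong)
    fix z assume "z \<in> G"
    then show "entry N x z * entry N z y
        = (if comparable x z \<and> comparable z y \<and> y \<in> G then 1 else 0)"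
      using assms by (simp add: entry_hasse)
  qed simp
  also have "\<dots> = card {z\<in>G. comparable x z \<and> comparable z y \<and> y \<in> G}"
    by (simp flip: sum.inter_filter)
  finally show ?thesis .
qed

text \<open>
  A vertex comparable to both edges is a common endpoint of them.
\<close>

lemma entry_hasse_square_edges:
  assumes "x \<in> edges G" "y \<in> edges G"
  shows "entry (N * N) x y = card (x \<inter> y)"
proof -
  have xy: "x \<in> G" "y \<in> G" "card x = 2" "card y = 2" using assms by (auto simp: edges_def)
  have "{z\<in>G. comparable x z \<and> comparable z y \<and> y \<in> G} = (\<lambda>a. {a}) ` (x \<inter> y)"
  proof (rule equalityI; rule subsetI)
    fix z assume "z \<in> {z\<in>G. comparable x z \<and> comparable z y \<and> y \<in> G}"
    then have z: "z \<in> G" "z \<subset> x" "z \<subset> y"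
      using psubset_cards[of x z] psubset_cards[of y z] xy by auto
    then have "card z = 1" using psubset_cards(1)[of z x] xy by blast
    with z show "z \<in> (\<lambda>a. {a}) ` (x \<inter> y)" by (auto simp: card_1_singleton_iff)
  next
    fix z assume "z \<in> (\<lambda>a. {a}) ` (x \<inter> y)"
    then obtain a where a: "z = {a}" "a \<in> x" "a \<in> y" by blast
    have "{a} \<noteq> x" "{a} \<noteq> y" using xy by auto
    with a xy face[of x "{a}"] show "z \<in> {z\<in>G. comparable x z \<and> comparable z y \<and> y \<in> G}" by auto
  qed
  then show ?thesis
    using xy by (simp add: entry_hasse_square card_image)
qed

lemma vertex_meets_edge:
  assumes "x \<in> vertices G" "y \<in> edges G"
  shows "x \<inter> y \<noteq> {} \<longleftrightarrow> comparable x y"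
proof -
  obtain a where x: "x = {a}" using assms(1) by (auto simp: vertices_iff card_1_singleton_iff)
  have "y \<noteq> {}" "y \<noteq> {a}" using assms(2) by (auto simp: edges_iff)
  then show ?thesis unfolding x psubset_eq subset_singleton_iff by auto
qed

text \<open>
  Two vertices meet only if they are equal, and a vertex meets an edge only if they are incident.
  Two edges share two vertices if they are equal and otherwise at most one, so that the entry 1 for
  meeting edges is the number of common vertices, diminished by one on the diagonal.
\<close>

lemma connection_eq: "connection G = PV - PE + N + PE * N * N"
proof (rule kernel_eqI)
  fix x y
  have PENN: "entry (PE * N * N) x y = of_bool (x \<in> edges G) * entry (N * N) x y"
    by (simp add: mult.assoc entry_projection_mult)
  have con: "entry (connection G) x y = of_bool (x \<in> G \<and> y \<in> G \<and> x \<inter> y \<noteq> {})"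
    by (auto simp: connection_def)
  consider "x \<notin> G \<or> y \<notin> G" | "x \<in> vertices G" "y \<in> vertices G" | "x \<in> vertices G" "y \<in> edges G"
    | "x \<in> edges G" "y \<in> vertices G" | "x \<in> edges G" "y \<in> edges G"
    using G_split by blast
  then show "entry (connection G) x y = entry (PV - PE + N + PE * N * N) x y"
  proof cases
    case 1
    then have "x \<notin> G \<or> entry (N * N) x y = 0"
      by (auto simp: entry_hasse_square)
    with 1 show ?thesis
      by (auto simp: PENN con entry_hasse vertices_iff edges_iff simp del: entry_kernel_on)
  next
    case 2
    then show ?thesis
      using psubset_cards[of x y] psubset_cards[of y x]
      by (auto simp: PENN con entry_hasse vertices_iff edges_iff card_1_singleton_iff)
  next
    case 3
    then show ?thesis
      using vertex_meets_edge[of x y]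
      by (auto simp: PENN con entry_hasse vertices_iff edges_iff)
  next
    case 4
    then have "x \<inter> y \<noteq> {} \<longleftrightarrow> comparable x y"
      using vertex_meets_edge[of y x] by (simp add: Int_commute disj_commute)
    moreover have "\<not> (comparable x z \<and> comparable z y)" if "z \<in> G" for z
    proof
      assume c: "comparable x z \<and> comparable z y"
      have "x \<in> G" "card x = 2" "y \<in> G" "card y = 1"
        using 4 by (simp_all add: vertices_iff edges_iff)
      then have "card z = 1" "card z = 2"
        using comparable_cards(2)[of x z] comparable_cards(2)[of z y] c that by blast+
      then show False by simp
    qed
    then have "{z\<in>G. comparable x z \<and> comparable z y \<and> y \<in> G} = {}"
      by blast
    moreover have "x \<noteq> y" "x \<notin> vertices G" "y \<notin> edges G" using 4 G_split(2) by auto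
    ultimately show ?thesis using 4
      by (simp add: PENN con entry_hasse entry_hasse_square vertices_iff edges_iff)
  next
    case 5
    then have xy: "x \<in> G" "y \<in> G" "card x = 2" "card y = 2" by (auto simp: edges_def)
    have "card (x \<inter> y) = of_bool (x \<inter> y \<noteq> {}) + of_bool (x = y)"
    proof (cases "x = y")
      case True
      then show ?thesis using xy by auto
    next
      case False
      then have "x \<inter> y \<subset> x" using xy card_subset_eq[of y x] simplex_finite by auto
      then show ?thesis using finite_card_2_subsets[of x "x \<inter> y"] xy False by auto
    qed
    moreover have "\<not> comparable x y" using comparable_cards[of x y] xy by auto
    moreover have "x \<notin> vertices G" using 5 G_split(2) by auto
    ultimately show ?thesis using 5 xy
      by (simp add: PENN con entry_hasse entry_hasse_square_edges)
  qed
qed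

lemma projection_rules:
  "PV * (N * A) = N * (PE * A)" "PE * (N * A) = N * (PV * A)"
  "PV * (PV * A) = PV * A" "PE * (PE * A) = PE * A" "PV * (PE * A) = 0" "PE * (PV * A) = 0"
  by (simp_all flip: mult.assoc add: PV_hasse PE_hasse projection_mult)

text \<open>
  On \<open>G\<close> this says \<open>L - L\<^sup>-\<^sup>1 = N\<^sup>2\<close>. Projections are moved to the right through \<open>N\<close>, which exchanges
  them.
\<close>

lemma connection_square:
  "connection G * connection G = N * N * connection G + projection G"
proof -
  have L: "connection G = PV - PE + (N * PV + N * PE) + PE * N * N"
    using connection_eq hasse_split by metis
  show ?thesis
    unfolding L PV_plus_PE[symmetric]
    by (simp add: algebra_simps projection_rules PV_hasse PE_hasse projection_mult)
qed

end

section \<open>Traces of incidence and connection kernels\<close>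

context graph_complex
begin

lemma vertices_subset: "vertices G \<subseteq> G" and edges_subset: "edges G \<subseteq> G"
  by (auto simp: vertices_def edges_def)

lemma block_projections [simp]: "block G PV" "block G PE" "block G (projection G)"
  using vertices_subset edges_subset by simp_all

lemma trace_projection_mult: "trace_on G (projection G * A) = trace_on G A"
  unfolding trace_on_def
proof (rule sum.cong)
  fix x assume "x \<in> G"
  then show "entry (projection G * A) x x = entry A x x"
    by (subst entry_times[of "{x}"]) auto
qed simp

lemma trace_mult_projection_mult:
  assumes "block G A" "block G B"
  shows "trace_on G (A * (projection G * B)) = trace_on G (A * B)"
proof -
  have "trace_on G (A * (projection G * B)) = trace_on G (projection G * (B * A))"
    using assms by (simp add: trace_on_commute[of G A] mult.assoc)
  also have "\<dots> = trace_on G (A * B)"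
    using assms by (simp add: trace_projection_mult trace_on_commute[of G A])
  finally show ?thesis .
qed

lemma PV_hasse_power:
  "PV * N ^ (2 * j) = N ^ (2 * j) * PV" "PV * N ^ Suc (2 * j) = N ^ Suc (2 * j) * PE"
proof (induction j)
  case 0
  show "PV * N ^ (2 * 0) = N ^ (2 * 0) * PV" "PV * N ^ Suc (2 * 0) = N ^ Suc (2 * 0) * PE"
    by (simp_all add: PV_hasse)
next
  case (Suc j)
  show 1: "PV * N ^ (2 * Suc j) = N ^ (2 * Suc j) * PV"
    using Suc.IH(1) by (simp add: projection_rules) (simp add: mult.assoc)
  then show "PV * N ^ Suc (2 * Suc j) = N ^ Suc (2 * Suc j) * PE"
    by (simp only: power_Suc2 flip: mult.assoc) (simp add: mult.assoc PV_hasse)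
qed

text \<open>
  An odd walk in a bipartite graph is not closed.
\<close>

lemma trace_hasse_odd: "trace_on G (N ^ Suc (2 * j)) = 0"
proof -
  let ?K = "N ^ Suc (2 * j)"
  have eq: "trace_on G (PV * ?K) = 0"
  proof -
    have "trace_on G (PV * ?K) = trace_on G (PV * (PV * ?K))"
      by (simp only: projection_rules)
    also have "\<dots> = trace_on G (PV * ?K * PV)"
      by (rule trace_on_commute) simp_all
    also have "\<dots> = 0"
      unfolding PV_hasse_power mult.assoc projection_mult by simp
    finally show ?thesis .
  qed
  have "trace_on G (PE * ?K) = trace_on G (?K * PE)"
    by (rule trace_on_commute) simp_all
  also have "\<dots> = 0" using eq by (simp only: PV_hasse_power)
  finally show ?thesis
    using eq trace_projection_mult[of ?K] by (simp add: distrib_right flip: PV_plus_PE)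
qed

text \<open>
  Rotating a closed walk by one step turns walks based at a vertex into walks based at an edge.
\<close>

lemma trace_hasse_even_split:
  "trace_on G (N ^ (2 * Suc j) * PV) = trace_on G (N ^ (2 * Suc j) * PE)"
proof -
  have "trace_on G (N * (N ^ Suc (2 * j) * PV)) = trace_on G (N ^ Suc (2 * j) * PV * N)"
    by (rule trace_on_commute) (simp_all del: power_Suc)
  also have "\<dots> = trace_on G (N ^ Suc (2 * j) * N * PE)"
    by (simp only: mult.assoc PV_hasse)
  also have "N ^ Suc (2 * j) * N = N ^ (2 * Suc j)" by (simp add: mult.assoc power_commutes)
  finally show ?thesis by (simp add: mult.assoc power_commutes)
qed

lemma trace_hasse_even_PV: "trace_on G (N ^ (2 * Suc j)) = 2 * trace_on G (N ^ (2 * Suc j) * PV)"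
proof -
  have "trace_on G (N ^ (2 * Suc j)) = trace_on G (projection G * N ^ (2 * Suc j))"
    by (simp only: trace_projection_mult)
  also have "\<dots> = trace_on G (N ^ (2 * Suc j) * projection G)"
    by (rule trace_on_commute) simp_all
  finally show ?thesis
    using trace_hasse_even_split[of j] by (simp add: distrib_left flip: PV_plus_PE)
qed

lemma hasse_power_Suc: "N ^ (2 * Suc j) = N ^ (2 * j) * (N * N)"
  using power_add[of N "2 * j" 2] by (simp add: power2_eq_square)

lemma trace_hasse_connection:
  "trace_on G (N ^ (2 * j) * connection G)
    = of_bool (j = 0) * (real (card (vertices G)) - real (card (edges G)))
      + trace_on G (N ^ (2 * Suc j)) / 2"
proof -
  have "trace_on G (N ^ (2 * j) * connection G)
      = (trace_on G (N ^ (2 * j) * PV) - trace_on G (N ^ (2 * j) * PE))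
        + trace_on G (N ^ Suc (2 * j)) + trace_on G (N ^ (2 * j) * (PE * N * N))"
    unfolding connection_eq by (simp add: algebra_simps power_commutes)
  moreover have "trace_on G (N ^ (2 * j) * (PE * N * N)) = trace_on G (N ^ (2 * Suc j)) / 2"
  proof -
    have "PE * N * N = N * N * PE"
      by (simp add: mult.assoc PE_hasse PV_hasse projection_rules)
    then have "N ^ (2 * j) * (PE * N * N) = N ^ (2 * Suc j) * PE"
      by (simp only: hasse_power_Suc mult.assoc)
    then show ?thesis
      using trace_hasse_even_PV[of j] trace_hasse_even_split[of j] by simp
  qed
  moreover have "trace_on G (N ^ (2 * j) * PV) - trace_on G (N ^ (2 * j) * PE)
      = of_bool (j = 0) * (real (card (vertices G)) - real (card (edges G)))"
  proof (cases j)
    case 0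
    have "(\<Sum>x\<in>G. of_bool (x \<in> X) :: real) = card X" if "X \<subseteq> G" for X
    proof -
      have "(\<Sum>x\<in>G. of_bool (x \<in> X) :: real) = (\<Sum>x\<in>X. 1)"
        by (rule sum.mono_neutral_cong_right) (use that in auto)
      then show ?thesis by simp
    qed
    then show ?thesis
      using vertices_subset edges_subset 0 by (simp add: trace_on_def)
  next
    case (Suc i)
    then show ?thesis using trace_hasse_even_split[of i] by simp
  qed
  ultimately show ?thesis using trace_hasse_odd[of j] by linarith
qed

text \<open>
  Multiplying \<open>L\<^sup>2 = N\<^sup>2 L + 1\<close> by powers; the same recursion holds for the powers of the roots of
  \<open>t\<^sup>2 = y t + 1\<close>, with \<open>y\<close> in the place of \<open>N\<^sup>2\<close>.
\<close>

lemma trace_connection_step: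
  "trace_on G (N ^ (2 * j) * connection G ^ Suc (Suc m))
    = trace_on G (N ^ (2 * Suc j) * connection G ^ Suc m) + trace_on G (N ^ (2 * j) * connection G ^ m)"
proof -
  have "connection G ^ Suc (Suc m) = (connection G * connection G) * connection G ^ m"
    by (simp add: mult.assoc)
  also have "\<dots> = N * N * connection G ^ Suc m + projection G * connection G ^ m"
    by (simp add: connection_square distrib_right mult.assoc)
  finally have "N ^ (2 * j) * connection G ^ Suc (Suc m)
      = N ^ (2 * Suc j) * connection G ^ Suc m + N ^ (2 * j) * (projection G * connection G ^ m)"
    by (simp only: hasse_power_Suc distrib_left mult.assoc)
  then show ?thesis by (simp only: trace_on_simps trace_mult_projection_mult block_power block_complex)
qed

end

section \<open>Barycentric refinement of a graph\<close>

text \<open>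
  The map \<open>f\<close> names the simplices that become vertices of the refinement. Allowing any type for
  the names covers an iteration within one type.
\<close>

locale graph_refinement = graph_complex G for G :: "'v set set" +
  fixes f :: "'v set \<Rightarrow> 'w"
  assumes inj: "inj_on f G"
begin

definition R :: "'w set set" where
  "R = (\<lambda>c. f ` c) ` barycentric_refinement G"

lemma comparable_card_ne:
  assumes "x \<in> G" "y \<in> G" "comparable x y"
  shows "card x \<noteq> card y"
  using comparable_cards[OF assms] card_cases[OF assms(1)] by auto

text \<open>
  Three pairwise comparable simplices would need three different cardinalities.
\<close>

lemma barycentric_refinement_eq:
  "barycentric_refinement G = (\<lambda>x. {x}) ` G \<union> {{x, y} |x y. x \<in> G \<and> y \<in> G \<and> x \<subset> y}"
proof (rule equalityI; rule subsetI)
  fix K assume "K \<in> barycentric_refinement G"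
  then have K: "K \<subseteq> G" "K \<noteq> {}" and cmp: "\<And>u v. u \<in> K \<Longrightarrow> v \<in> K \<Longrightarrow> u \<noteq> v \<Longrightarrow> comparable u v"
    by (auto simp: barycentric_refinement_def whitney_complex_def)
  obtain x where x: "x \<in> K" using K by blast
  show "K \<in> (\<lambda>x. {x}) ` G \<union> {{x, y} |x y. x \<in> G \<and> y \<in> G \<and> x \<subset> y}"
  proof (cases "K = {x}")
    case True
    with x K show ?thesis by blast
  next
    case False
    then obtain y where y: "y \<in> K" "y \<noteq> x" using x by blast
    have "z = x \<or> z = y" if z: "z \<in> K" for z
    proof (rule ccontr)
      assume ne: "\<not> (z = x \<or> z = y)"
      have "x \<in> G" "y \<in> G" "z \<in> G" using x y z K by auto
      then have "card x \<noteq> card y" "card z \<noteq> card x" "card z \<noteq> card y"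
        using comparable_card_ne cmp x y z ne by blast+
      then show False
        using card_cases[OF \<open>x \<in> G\<close>] card_cases[OF \<open>y \<in> G\<close>] card_cases[OF \<open>z \<in> G\<close>]
        by linarith
    qed
    then have "K = {x, y}" using x y by blast
    moreover have "{x, y} = {y, x}" by blast
    moreover have "comparable x y" using cmp x y by blast
    moreover have "x \<in> G" "y \<in> G" using x y K by auto
    ultimately show ?thesis by blast
  qed
next
  fix K assume "K \<in> (\<lambda>x. {x}) ` G \<union> {{x, y} |x y. x \<in> G \<and> y \<in> G \<and> x \<subset> y}"
  then show "K \<in> barycentric_refinement G"
    by (auto simp: barycentric_refinement_def whitney_complex_def)
qed

lemma R_cases:
  assumes "z \<in> R"
  obtains x where "x \<in> G" "z = {f x}" | x y where "x \<in> G" "y \<in> G" "x \<subset> y" "z = {f x, f y}"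
  using assms unfolding R_def barycentric_refinement_eq by auto

lemma f_eq_iff [simp]: "x \<in> G \<Longrightarrow> y \<in> G \<Longrightarrow> f x = f y \<longleftrightarrow> x = y"
  using inj by (auto simp: inj_on_def)

lemma vertex_in_R: "x \<in> G \<Longrightarrow> {f x} \<in> R"
  unfolding R_def barycentric_refinement_eq by blast

lemma edge_in_R: "x \<in> G \<Longrightarrow> y \<in> G \<Longrightarrow> x \<subset> y \<Longrightarrow> {f x, f y} \<in> R"
  unfolding R_def barycentric_refinement_eq
  by (rule image_eqI[of _ _ "{x, y}"]) auto

lemma edge_in_R': "x \<in> G \<Longrightarrow> y \<in> G \<Longrightarrow> comparable x y \<Longrightarrow> {f x, f y} \<in> R"
  using edge_in_R[of x y] edge_in_R[of y x] by (auto simp: insert_commute)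

lemma card_edge: "x \<in> G \<Longrightarrow> y \<in> G \<Longrightarrow> x \<noteq> y \<Longrightarrow> card {f x, f y} = 2"
  by simp

sublocale R: graph_complex R
proof
  show "finite_simplicial_complex R"
    unfolding R_def
    by (intro finite_simplicial_complex_image finite_simplicial_complex_barycentric_refinement complex)
  show "card z \<le> 2" if "z \<in> R" for z
    using that by (rule R_cases) auto
qed

lemma vertices_R: "vertices R = (\<lambda>x. {f x}) ` G"
proof -
  have "z \<in> (\<lambda>x. {f x}) ` G" if "z \<in> R" "card z = 1" for z
    using that(1)
  proof (rule R_cases)
    fix x y assume "x \<in> G" "y \<in> G" "x \<subset> y" "z = {f x, f y}"
    then show ?thesis using card_edge[of x y] that(2) by auto
  qed auto
  then show ?thesis using vertex_in_R by (auto simp: vertices_def)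
qed

lemma edges_R: "edges R = (\<lambda>(x, y). {f x, f y}) ` {(x, y). x \<in> G \<and> y \<in> G \<and> x \<subset> y}"
proof -
  have "z \<in> (\<lambda>(x, y). {f x, f y}) ` {(x, y). x \<in> G \<and> y \<in> G \<and> x \<subset> y}"
    if "z \<in> R" "card z = 2" for z
    using that(1)
  proof (rule R_cases)
    fix x y assume "x \<in> G" "y \<in> G" "x \<subset> y" "z = {f x, f y}"
    then show ?thesis by auto
  qed (use that(2) in auto)
  moreover have "{f x, f y} \<in> R \<and> card {f x, f y} = 2" if "x \<in> G" "y \<in> G" "x \<subset> y" for x y
    using that edge_in_R[of x y] card_edge[of x y] by blast
  ultimately show ?thesis unfolding edges_def by fast
qed

lemma inj_on_vertex: "inj_on (\<lambda>x. {f x}) G"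
  by (auto simp: inj_on_def)

lemma card_vertices_R: "card (vertices R) = card G"
  unfolding vertices_R by (rule card_image[OF inj_on_vertex])

text \<open>
  An edge of the refinement is an incident pair of a vertex and an edge, and each edge has two
  endpoints.
\<close>

lemma card_edges_R: "card (edges R) = 2 * card (edges G)"
proof -
  let ?P = "{(x, y). x \<in> G \<and> y \<in> G \<and> x \<subset> y}"
  have "inj_on (\<lambda>(x, y). {f x, f y}) ?P"
    by (rule inj_onI) (auto simp: doubleton_eq_iff)
  then have "card (edges R) = card ?P" unfolding edges_R by (rule card_image)
  also have "?P = (\<lambda>(y, x). (x, y)) ` (SIGMA y:edges G. {x\<in>G. x \<subset> y})"
    using psubset_cards(2) by (fastforce simp: edges_def image_iff)
  also have "card \<dots> = card (SIGMA y:edges G. {x\<in>G. x \<subset> y})"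
    by (rule card_image) (auto simp: inj_on_def)
  also have "\<dots> = (\<Sum>y\<in>edges G. card {x\<in>G. x \<subset> y})"
    by (rule card_SigmaI) auto
  also have "\<dots> = (\<Sum>y\<in>edges G. 2)"
    by (intro sum.cong) (auto simp: edges_def card_faces)
  finally show ?thesis by simp
qed

lemma edges_above_vertex:
  assumes x: "x \<in> G"
  shows "{z\<in>R. comparable {f x} z} = (\<lambda>y. {f x, f y}) ` {y\<in>G. comparable x y}"
proof (rule equalityI; rule subsetI)
  fix z assume "z \<in> {z\<in>R. comparable {f x} z}"
  then have z: "z \<in> R" "comparable {f x} z" by auto
  have "z \<noteq> {}" using R.simplex_nonempty[OF z(1)] .
  then have sub: "{f x} \<subset> z" using z(2) by blast
  from z(1) show "z \<in> (\<lambda>y. {f x, f y}) ` {y\<in>G. comparable x y}"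
  proof (rule R_cases)
    fix y assume "y \<in> G" "z = {f y}"
    then show ?thesis using sub by auto
  next
    fix u v assume uv: "u \<in> G" "v \<in> G" "u \<subset> v" "z = {f u, f v}"
    then have "x = u \<or> x = v" using sub x by auto
    then show ?thesis using uv by (auto simp: insert_commute)
  qed
next
  fix z assume "z \<in> (\<lambda>y. {f x, f y}) ` {y\<in>G. comparable x y}"
  then obtain y where y: "y \<in> G" "comparable x y" "z = {f x, f y}" by blast
  then have "f x \<noteq> f y" using x by auto
  then show "z \<in> {z\<in>R. comparable {f x} z}"
    using y edge_in_R'[OF x y(1,2)] by auto
qed

lemma incidences_R_vertex:
  assumes "x \<in> G"
  shows "incidences R {f x} = incidences G x"
proof -
  have "inj_on (\<lambda>y. {f x, f y}) {y\<in>G. comparable x y}"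
    by (rule inj_onI) (use assms in \<open>auto simp: doubleton_eq_iff\<close>)
  then show ?thesis
    unfolding incidences_def edges_above_vertex[OF assms] by (rule card_image)
qed

abbreviation D :: "'v set kernel" where
  "D \<equiv> kernel_on G (\<lambda>x y. of_bool (x = y) * real (incidences G x))"

text \<open>
  A walk of length 2 between vertices \<open>{f x}\<close> and \<open>{f y}\<close> of the refinement goes through an edge
  that contains both: only \<open>{f x, f y}\<close> for \<open>x \<noteq> y\<close>, and any edge at \<open>{f x}\<close> for \<open>x = y\<close>.
\<close>

lemma hasse_square_refinement:
  assumes x: "x \<in> G" and y: "y \<in> G"
  shows "entry (R.N * R.N) {f x} {f y} = entry (N + D) x y"
proof (cases "x = y")
  case True
  have "entry (R.N * R.N) {f x} {f y} = incidences R {f x}"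
    using True x by (simp add: R.entry_hasse_square vertex_in_R incidences_def conj_commute disj_commute cong: conj_cong)
  then show ?thesis using True x by (simp add: incidences_R_vertex entry_hasse)
next
  case False
  have "{z\<in>R. comparable {f x} z \<and> comparable z {f y} \<and> {f y} \<in> R}
      = {z\<in>R. comparable {f x} z} \<inter> {z\<in>R. comparable {f y} z}"
    using y by (auto simp: vertex_in_R)
  also have "\<dots> = (if comparable x y then {{f x, f y}} else {})"
    unfolding edges_above_vertex[OF x] edges_above_vertex[OF y]
    using x y False by (auto simp: doubleton_eq_iff)
  finally have "entry (R.N * R.N) {f x} {f y} = of_bool (comparable x y)"
    using x by (simp add: R.entry_hasse_square vertex_in_R)
  then show ?thesis using x y False by (simp add: entry_hasse)
qed

text \<open>
  Walks of length 2 from a vertex end at a vertex, so the identity for squares is multiplicative.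
\<close>

lemma hasse_power_refinement:
  assumes x: "x \<in> G" and y: "y \<in> G"
  shows "entry (R.N ^ (2 * j)) {f x} {f y} = entry ((N + D) ^ j) x y"
  using x
proof (induction j arbitrary: x)
  case 0
  then show ?case using y by simp
next
  case (Suc j)
  let ?A = "R.N * R.N"
  have zero: "entry ?A {f x} z = 0" if "z \<in> edges R" for z
  proof -
    have fx: "{f x} \<in> vertices R" using Suc.prems by (simp add: vertices_R)
    then have "entry ?A {f x} z = entry (R.PV * ?A) {f x} z"
      by (simp only: R.entry_projection_mult of_bool_eq mult_1_left)
    also have "R.PV * ?A = R.N * (R.N * R.PV)"
      by (simp add: R.PE_hasse R.PV_hasse R.projection_rules)
    also have "entry (R.N * (R.N * R.PV)) {f x} z
        = (\<Sum>w\<in>R. entry R.N {f x} w * entry (R.N * R.PV) w z)"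
      by (rule entry_mult_block) (use Suc.prems in \<open>simp_all add: vertex_in_R\<close>)
    also have "\<dots> = 0"
      using that R.G_split(2) by (auto intro!: sum.neutral simp: R.entry_hasse_projection)
    finally show ?thesis .
  qed
  have "R.N ^ (2 * Suc j) = ?A * R.N ^ (2 * j)" by (simp add: mult.assoc)
  then have "entry (R.N ^ (2 * Suc j)) {f x} {f y}
      = (\<Sum>z\<in>R. entry ?A {f x} z * entry (R.N ^ (2 * j)) z {f y})"
    using Suc.prems by (subst entry_mult_block[of R, symmetric]) (auto simp: vertex_in_R)
  also have "\<dots> = (\<Sum>z\<in>vertices R. entry ?A {f x} z * entry (R.N ^ (2 * j)) z {f y})"
    using R.G_split zero by (intro sum.mono_neutral_right) auto
  also have "\<dots> = (\<Sum>z\<in>G. entry (N + D) x z * entry ((N + D) ^ j) z y)"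
    unfolding vertices_R
    by (subst sum.reindex[OF inj_on_vertex])
       (use Suc in \<open>auto intro!: sum.cong simp: hasse_square_refinement Suc.IH simp del: entry_simps\<close>)
  also have "\<dots> = entry ((N + D) ^ Suc j) x y"
    unfolding power_Suc by (rule entry_mult_block[symmetric]) (use Suc.prems in simp_all)
  finally show ?case .
qed

text \<open>
  The factor 2 accounts for the closed walks based at edges.
\<close>

lemma trace_refinement:
  "trace_on R (R.N ^ (2 * Suc j)) = 2 * trace_on G ((N + D) ^ Suc j)"
proof -
  have "trace_on R (R.N ^ (2 * Suc j) * R.PV) = trace_on R (R.PV * R.N ^ (2 * Suc j))"
    by (simp only: R.PV_hasse_power)
  also have "\<dots> = (\<Sum>z\<in>vertices R. entry (R.N ^ (2 * Suc j)) z z)"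
    unfolding trace_on_def R.entry_projection_mult
    using R.vertices_subset by (intro sum.mono_neutral_cong_right) (auto simp: vertices_R)
  also have "\<dots> = trace_on G ((N + D) ^ Suc j)"
    unfolding vertices_R trace_on_def
    by (subst sum.reindex[OF inj_on_vertex])
       (auto intro!: sum.cong simp: hasse_power_refinement simp del: power_Suc mult_Suc_right)
  finally show ?thesis by (simp only: R.trace_hasse_even_PV)
qed

end

section \<open>Moments of the limiting spectral density\<close>

lemma integral_periodic_shift:
  fixes g :: "real \<Rightarrow> real"
  assumes g: "continuous_on UNIV g" and per: "\<And>x. g (x + 1) = g x"
  shows "integral {0..1} (\<lambda>x. g (x + 1/2)) = integral {0..1} g"
proof -
  have int: "g integrable_on {a..b}" for a b
    by (rule integrable_continuous_real) (rule continuous_on_subset[OF g], simp)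
  have "integral {0..1} (\<lambda>x. g (x + 1/2)) = integral {1/2..3/2} g"
    using integral_shift_real_ivl[of "1/2" "1/2" "3/2" g] by simp
  also have "\<dots> = integral {1/2..1} g + integral {1..3/2} g"
    by (rule Henstock_Kurzweil_Integration.integral_combine[symmetric]) (use int in auto)
  also have "integral {1..3/2} g = integral {0..1/2} g"
    using integral_shift_real_ivl[of 1 1 "3/2" g] by (simp add: per)
  also have "integral {1/2..1} g + integral {0..1/2} g = integral {0..1} g"
    using Henstock_Kurzweil_Integration.integral_combine[of 0 "1/2" 1 g] int by simp
  finally show ?thesis .
qed

text \<open>
  The doubling map of the circle preserves its Haar measure.
\<close>

lemma integral_periodic_double:
  fixes g :: "real \<Rightarrow> real"
  assumes g: "continuous_on UNIV g" and per: "\<And>x. g (x + 1) = g x"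
  shows "integral {0..1} (\<lambda>x. g (2 * x)) = integral {0..1} g"
proof -
  have int: "g integrable_on {a..b}" for a b
    by (rule integrable_continuous_real) (rule continuous_on_subset[OF g], simp)
  have "((\<lambda>x. g (2 * x + 0)) has_integral (integral {0..2} g /\<^sub>R 2 ^ DIM(real)))
      (cbox ((0 - 0) /\<^sub>R 2) ((2 - 0) /\<^sub>R 2))"
    using has_integral_affinity'[of g "integral {0..2} g" 0 2 2 0] int[of 0 2]
    by (simp add: has_integral_integral)
  then have "integral {0..1} (\<lambda>x. g (2 * x)) = integral {0..2} g / 2"
    by (simp add: integral_unique)
  also have "integral {0..2} g = integral {0..1} g + integral {1..2} g"
    using Henstock_Kurzweil_Integration.integral_combine[of 0 1 2 g] int by simp
  also have "integral {1..2} g = integral {0..1} g"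
    using integral_shift_real_ivl[of 1 1 2 g] by (simp add: per)
  finally show ?thesis by simp
qed

text \<open>
  On the infinite path, Fourier transform turns \<open>N\<close> into multiplication by \<open>2 cos \<theta>\<close>. For uniformly
  distributed \<open>x\<close>, this function has the distribution of \<open>(2 cos \<theta>)\<^sup>2\<close>, and \<open>hop\<close> below, which differs
  from it by the constant 2, that of \<open>2 cos \<theta>\<close>.
\<close>

abbreviation symbol :: "real \<Rightarrow> real" where
  "symbol x \<equiv> 4 * (sin (pi * x))\<^sup>2"

abbreviation hop :: "real \<Rightarrow> real" where
  "hop x \<equiv> - 2 * cos (2 * pi * x)"

definition moment :: "nat \<Rightarrow> nat \<Rightarrow> real" where
  "moment j i = integral {0..1} (\<lambda>x. symbol x ^ j * hop x ^ i)"

lemma symbol_eq: "symbol x = 2 + hop x"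
  using cos_double_sin[of "pi * x"] by (simp add: mult_ac)

text \<open>
  Angle doubling, with a shift of the variable that turns the cosine into a sine.
\<close>

lemma hop_square: "(hop x)\<^sup>2 = symbol (2 * x + 1/2)"
proof -
  have "sin (pi * (2 * x + 1/2)) = cos (2 * pi * x)"
    using sin_add[of "2 * pi * x" "pi / 2"] by (simp add: algebra_simps)
  then show ?thesis by (simp add: power_mult_distrib)
qed

lemma moment_Suc: "moment (Suc j) i = 2 * moment j i + moment j (Suc i)"
proof -
  have "s ^ Suc j * h ^ i = 2 * (s ^ j * h ^ i) + s ^ j * h ^ Suc i" if "s = 2 + h" for s h :: real
  proof -
    have "s ^ Suc j * h ^ i = (2 + h) * (s ^ j * h ^ i)" by (simp add: that)
    then show ?thesis by (simp add: algebra_simps)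
  qed
  then have "moment (Suc j) i
      = integral {0..1} (\<lambda>x. 2 * (symbol x ^ j * hop x ^ i) + symbol x ^ j * hop x ^ Suc i)"
    unfolding moment_def using symbol_eq by presburger
  also have "\<dots> = integral {0..1} (\<lambda>x. 2 * (symbol x ^ j * hop x ^ i))
      + integral {0..1} (\<lambda>x. symbol x ^ j * hop x ^ Suc i)"
    by (intro integral_add integrable_continuous_real continuous_intros)
  finally show ?thesis by (simp only: moment_def integral_mult_right)
qed

lemma moment_0_0: "moment 0 0 = 1"
  by (simp add: moment_def)

lemma moment_0_odd: "moment 0 (Suc (2 * l)) = 0"
proof -
  have "moment 0 (Suc (2 * l)) = integral {0..1} (\<lambda>x. hop (x + 1/2) ^ Suc (2 * l))"
    unfolding moment_def power_0 mult_1_left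
  proof (rule integral_periodic_shift[symmetric])
    fix x :: real
    have "cos (2 * pi * (x + 1)) = cos (2 * pi * x)"
      using cos_periodic[of "2 * pi * x"] by (simp add: algebra_simps)
    then show "hop (x + 1) ^ Suc (2 * l) = hop x ^ Suc (2 * l)" by simp
  qed (intro continuous_intros)
  also have "\<dots> = integral {0..1} (\<lambda>x. - (hop x ^ Suc (2 * l)))"
  proof (rule arg_cong[where f = "integral _"], rule ext)
    fix x :: real
    have "cos (2 * pi * (x + 1/2)) = - cos (2 * pi * x)"
      using cos_periodic_pi[of "2 * pi * x"] by (simp add: algebra_simps)
    then have "hop (x + 1/2) = - hop x" by simp
    then show "hop (x + 1/2) ^ Suc (2 * l) = - (hop x ^ Suc (2 * l))"
      by (metis even_Suc even_mult_iff even_numeral power_minus_odd)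
  qed
  also have "\<dots> = - moment 0 (Suc (2 * l))"
    unfolding moment_def power_0 mult_1_left by (rule integral_neg)
  finally show ?thesis by simp
qed

lemma moment_0_even: "moment 0 (2 * l) = moment l 0"
proof -
  have cont: "continuous_on UNIV (\<lambda>x. symbol x ^ l)" by (intro continuous_intros)
  have per: "symbol (x + 1) ^ l = symbol x ^ l" for x
    using sin_periodic_pi[of "pi * x"] by (simp add: distrib_left)
  have "moment 0 (2 * l) = integral {0..1} (\<lambda>x. symbol (2 * x + 1/2) ^ l)"
    unfolding moment_def power_0 mult_1_left power_mult hop_square ..
  also have "\<dots> = integral {0..1} (\<lambda>x. symbol (x + 1/2) ^ l)"
  proof (rule integral_periodic_double)
    show "continuous_on UNIV (\<lambda>x. symbol (x + 1/2) ^ l)" by (intro continuous_intros)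
    show "symbol (x + 1 + 1/2) ^ l = symbol (x + 1/2) ^ l" for x
      using per[of "x + 1/2"] by (simp only: ac_simps)
  qed
  also have "\<dots> = integral {0..1} (\<lambda>x. symbol x ^ l)"
    by (rule integral_periodic_shift[OF cont per])
  finally show ?thesis by (simp add: moment_def)
qed

text \<open>
  The factor \<open>1/2\<close> is the density with which each of the two branches contributes, as there are half
  as many vertices as simplices in the limit.
\<close>

definition branch_moment :: "nat \<Rightarrow> nat \<Rightarrow> real" where
  "branch_moment j m = 1/2 * integral {0..1}
     (\<lambda>x. symbol x ^ j * (f_plus (symbol x) ^ m + f_minus (symbol x) ^ m))"

lemma f_square: "(f_plus y)\<^sup>2 = y * f_plus y + 1" "(f_minus y)\<^sup>2 = y * f_minus y + 1"
proof -
  have "(sqrt (y\<^sup>2 + 4))\<^sup>2 = y\<^sup>2 + 4" by (rule real_sqrt_pow2) simp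
  then show "(f_plus y)\<^sup>2 = y * f_plus y + 1" "(f_minus y)\<^sup>2 = y * f_minus y + 1"
    by (simp_all add: f_plus_def f_minus_def power2_eq_square field_simps)
qed

lemma continuous_f [continuous_intros]:
  assumes "continuous_on S g"
  shows "continuous_on S (\<lambda>x. f_plus (g x))" "continuous_on S (\<lambda>x. f_minus (g x))"
  unfolding f_plus_def f_minus_def by (intro continuous_intros assms; simp)+

lemma branch_moment_0: "branch_moment j 0 = moment j 0"
  by (simp add: branch_moment_def moment_def)

lemma branch_moment_1: "branch_moment j 1 = moment (Suc j) 0 / 2"
proof -
  have "f_plus y + f_minus y = y" for y by (simp add: f_plus_def f_minus_def field_simps)
  then show ?thesis by (simp add: branch_moment_def moment_def mult.commute)
qed

lemma branch_moment_step:
  "branch_moment j (Suc (Suc m)) = branch_moment (Suc j) (Suc m) + branch_moment j m"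
proof -
  let ?F = "\<lambda>j m x. symbol x ^ j * (f_plus (symbol x) ^ m + f_minus (symbol x) ^ m)"
  have int: "?F j m integrable_on {0..1}" for j m
    by (intro integrable_continuous_real continuous_intros)
  have pow: "f_plus y ^ Suc (Suc m) = y * f_plus y ^ Suc m + f_plus y ^ m"
    "f_minus y ^ Suc (Suc m) = y * f_minus y ^ Suc m + f_minus y ^ m" for y
    using f_square[of y] by (simp_all add: power2_eq_square algebra_simps flip: mult.assoc)
  have "integral {0..1} (?F j (Suc (Suc m))) = integral {0..1} (\<lambda>x. ?F (Suc j) (Suc m) x + ?F j m x)"
    unfolding pow by (rule arg_cong[where f = "integral _"]) (simp add: fun_eq_iff algebra_simps)
  also have "\<dots> = integral {0..1} (?F (Suc j) (Suc m)) + integral {0..1} (?F j m)"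
    by (rule integral_add[OF int int])
  finally show ?thesis by (simp only: branch_moment_def distrib_left)
qed

section \<open>Spectral moments along a tower of refinements\<close>

lemma (in graph_complex) row_bounded_hasse:
  assumes "\<And>x. x \<in> G \<Longrightarrow> real (incidences G x) \<le> M"
  shows "row_bounded G M N"
  unfolding row_bounded_def
proof
  fix x assume x: "x \<in> G"
  have "(\<Sum>y\<in>G. \<bar>entry N x y\<bar>) = (\<Sum>y\<in>G. if comparable x y then 1 else 0)"
    by (rule sum.cong) (use x in \<open>simp_all add: entry_hasse\<close>)
  also have "\<dots> = incidences G x"
    by (simp add: incidences_def flip: sum.inter_filter)
  finally show "(\<Sum>y\<in>G. \<bar>entry N x y\<bar>) \<le> M" using assms[OF x] by simp
qed

lemma row_bounded_one: "row_bounded X 1 1"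
proof -
  have "(\<Sum>y\<in>X. \<bar>of_bool (x = y)\<bar>) \<le> (1 :: real)" if "x \<in> X" for x
  proof (cases "finite X")
    case True
    have "(\<Sum>y\<in>X. \<bar>of_bool (x = y)\<bar>) = (\<Sum>y\<in>X. if x = y then 1 else 0 :: real)"
      by (rule sum.cong) auto
    then show ?thesis using True by simp
  qed simp
  then show ?thesis by (simp add: row_bounded_def)
qed

lemma row_bounded_two: "row_bounded X 2 2"
  using row_bounded_add[OF row_bounded_one row_bounded_one, of X] by simp

text \<open>
  The \<open>l\<^sub>1\<close> distance of the diagonal kernel of incidence numbers from twice the identity: the
  obstruction to the graph being a disjoint union of cycles.
\<close>

definition (in graph_complex) defect :: real where
  "defect = (\<Sum>x\<in>G. \<bar>real (incidences G x) - 2\<bar>)"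

context graph_refinement
begin

lemma row_bounded_D:
  assumes "\<And>x. x \<in> G \<Longrightarrow> real (incidences G x) \<le> M"
  shows "row_bounded G M D"
  unfolding row_bounded_def
proof
  fix x assume x: "x \<in> G"
  have "(\<Sum>y\<in>G. \<bar>entry D x y\<bar>) = (\<Sum>y\<in>G. if x = y then real (incidences G x) else 0)"
    by (rule sum.cong) (use x in auto)
  also have "\<dots> = real (incidences G x)" using x by simp
  finally show "(\<Sum>y\<in>G. \<bar>entry D x y\<bar>) \<le> M" using assms[OF x] by simp
qed

lemma entry_two [simp]: "entry 2 x y = of_bool (x = y) * 2"
  using entry_simps(3)[of 1 1 x y] by (simp del: entry_simps(3) add: entry_simps(2))

lemma l1_norm_D_minus_two: "l1_norm_on G (N + D - (2 + N)) = defect"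
  unfolding l1_norm_on_def defect_def
proof (rule sum.cong)
  fix x assume x: "x \<in> G"
  have "(\<Sum>y\<in>G. \<bar>entry (N + D - (2 + N)) x y\<bar>)
      = (\<Sum>y\<in>G. if x = y then \<bar>real (incidences G x) - 2\<bar> else 0)"
    by (rule sum.cong) (use x in auto)
  also have "\<dots> = \<bar>real (incidences G x) - 2\<bar>" using x by simp
  finally show "(\<Sum>y\<in>G. \<bar>entry (N + D - (2 + N)) x y\<bar>) = \<bar>real (incidences G x) - 2\<bar>" .
qed simp

lemma entry_hasse_sym: "entry N x y = entry N y x"
  by (auto simp: entry_hasse)

text \<open>
  The error depends on the degrees and the defect only, not on the number of simplices.
\<close>

lemma trace_refinement_estimate:
  assumes M: "\<And>x. x \<in> G \<Longrightarrow> real (incidences G x) \<le> M" "2 \<le> M"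
  shows "\<bar>trace_on R (R.N ^ (2 * Suc j)) - 2 * trace_on G ((2 + N) ^ Suc j)\<bar>
    \<le> 2 * (real (Suc j) * (M + M) ^ j * defect)"
proof -
  have A: "row_bounded G (M + M) (N + D)"
    by (rule row_bounded_add[OF row_bounded_hasse[OF M(1)] row_bounded_D[OF M(1)]])
  have B: "row_bounded G (M + M) (2 + N)"
    by (rule row_bounded_mono[OF row_bounded_add[OF row_bounded_two row_bounded_hasse[OF M(1)]]])
       (use M(2) in auto)
  have "\<bar>trace_on G ((N + D) ^ Suc j - (2 + N) ^ Suc j)\<bar>
      \<le> l1_norm_on G ((N + D) ^ Suc j - (2 + N) ^ Suc j)"
    by (rule abs_trace_on_le) simp
  also have "\<dots> \<le> real (Suc j) * (M + M) ^ j * l1_norm_on G (N + D - (2 + N))"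
  proof (rule l1_norm_on_power_diff[OF _ _ _ A _ B])
    show "entry (N + D) x y = entry (N + D) y x" for x y
      using entry_hasse_sym[of x y] by auto
  qed (use M(2) in auto)
  finally show ?thesis
    unfolding l1_norm_D_minus_two trace_refinement trace_on_simps by linarith
qed

lemma incidences_R_le:
  assumes "\<And>x. x \<in> G \<Longrightarrow> real (incidences G x) \<le> M" "2 \<le> M" "z \<in> R"
  shows "real (incidences R z) \<le> M"
proof -
  consider "z \<in> vertices R" | "z \<in> edges R" using assms(3) R.G_split by blast
  then show ?thesis
  proof cases
    case 1
    then show ?thesis using assms(1) by (auto simp: vertices_R incidences_R_vertex)
  next
    case 2
    then show ?thesis using R.incidences_edge[of z] assms(2) by simp
  qed
qed

text \<open>
  New vertices lying inside an old edge have degree 2, the old vertices keep their degrees, and edges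
  do not contribute.
\<close>

lemma defect_R: "R.defect = defect"
proof -
  have "(\<Sum>z\<in>R. \<bar>real (incidences R z) - 2\<bar>) = (\<Sum>z\<in>vertices R. \<bar>real (incidences R z) - 2\<bar>)"
    using R.G_split by (intro sum.mono_neutral_right) (auto simp: R.incidences_edge)
  also have "\<dots> = defect"
    unfolding vertices_R defect_def
    by (subst sum.reindex[OF inj_on_vertex]) (auto intro!: sum.cong simp: incidences_R_vertex)
  finally show ?thesis by (simp only: R.defect_def)
qed

end

text \<open>
  Iterated refinement of a graph with at least one edge, inside one type.
\<close>

locale graph_tower =
  fixes X :: "nat \<Rightarrow> 'v set set" and f :: "nat \<Rightarrow> 'v set \<Rightarrow> 'v"
  assumes refinement: "graph_refinement (X n) (f n)"
    and X_Suc: "X (Suc n) = graph_refinement.R (X n) (f n)"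
    and nonempty: "edges (X 0) \<noteq> {}"
begin

sublocale X: graph_refinement "X n" "f n" for n
  by (rule refinement)

definition num_simplices :: "nat \<Rightarrow> real" where
  "num_simplices n = real (card (X n))"

text \<open>
  The Euler characteristic, which refinement preserves.
\<close>

definition euler :: real where
  "euler = real (card (vertices (X 0))) - real (card (edges (X 0)))"

lemma card_split: "card (X n) = card (vertices (X n)) + card (edges (X n))"
  by (subst X.G_split(1)[of n]) (rule card_Un_disjoint[OF X.finite_vertices X.finite_edges X.G_split(2)])

definition initial_edges :: nat where
  "initial_edges = card (edges (X 0))"

lemma initial_edges_pos: "initial_edges \<ge> 1"
  using nonempty by (simp add: initial_edges_def Suc_le_eq card_gt_0_iff)

lemma card_edges: "card (edges (X n)) = 2 ^ n * initial_edges"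
  by (induction n) (simp_all add: X_Suc X.card_edges_R initial_edges_def)

lemma euler_eq: "real (card (vertices (X n))) - real (card (edges (X n))) = euler"
proof (induction n)
  case (Suc n)
  then show ?case
    using card_split[of n] by (simp add: X_Suc X.card_edges_R X.card_vertices_R)
qed (simp add: euler_def)

lemma size_eq: "num_simplices n = 2 * real (card (edges (X n))) + euler"
  using euler_eq[of n] card_split[of n] by (simp add: num_simplices_def)

lemma size_pos: "num_simplices n > 0"
proof -
  have "card (edges (X n)) > 0" using initial_edges_pos by (simp add: card_edges)
  then show ?thesis using card_split[of n] by (simp add: num_simplices_def)
qed

lemma size_at_top: "filterlim num_simplices at_top sequentially"
proof -
  have le: "2 ^ n \<le> num_simplices n" for n
  proof -
    have "(2::real) ^ n \<le> real (card (edges (X n)))"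
      using initial_edges_pos by (simp add: card_edges)
    also have "\<dots> \<le> num_simplices n" using card_split[of n] by (simp add: num_simplices_def)
    finally show ?thesis .
  qed
  have "filterlim (\<lambda>n. (2::real) ^ n) at_top sequentially"
    by real_asymp
  then show ?thesis by (rule filterlim_at_top_mono) (use le in simp)
qed

lemma const_over_size: "(\<lambda>n. c / num_simplices n) \<longlonglongrightarrow> 0"
  by (rule tendsto_divide_0[OF tendsto_const filterlim_at_top_imp_at_infinity[OF size_at_top]])

lemma size_ratio: "(\<lambda>n. 2 * num_simplices n / num_simplices (Suc n)) \<longlonglongrightarrow> 1"
proof -
  have "2 * num_simplices n / num_simplices (Suc n) = 1 + euler / num_simplices (Suc n)" for n
  proof -
    have "2 * num_simplices n = num_simplices (Suc n) + euler"
      by (simp add: size_eq card_edges)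
    then show ?thesis using size_pos[of "Suc n"] by (simp add: field_simps)
  qed
  moreover have "(\<lambda>n. 1 + euler / num_simplices (Suc n)) \<longlonglongrightarrow> 1 + 0"
    by (intro tendsto_add tendsto_const LIMSEQ_Suc const_over_size)
  ultimately show ?thesis by simp
qed

definition max_inc :: real where
  "max_inc = real (card (X 0)) + 2"

lemma incidences_le: "x \<in> X n \<Longrightarrow> real (incidences (X n) x) \<le> max_inc"
proof (induction n arbitrary: x)
  case 0
  have "incidences (X 0) x \<le> card (X 0)"
    unfolding incidences_def by (rule card_mono) auto
  then show ?case by (simp add: max_inc_def)
next
  case (Suc n)
  then show ?case unfolding X_Suc by (intro X.incidences_R_le) (auto simp: max_inc_def)
qed

lemma defect_eq: "X.defect n = X.defect 0"
proof (induction n)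
  case (Suc n)
  have "X.defect (Suc n) = X.defect n"
    unfolding X_Suc by (rule X.defect_R)
  with Suc show ?case by simp
qed simp

definition trace_limit :: "nat \<Rightarrow> nat \<Rightarrow> bool" where
  "trace_limit j i \<longleftrightarrow> (\<lambda>n. trace_on (X n) ((2 + X.N n) ^ j * X.N n ^ i) / num_simplices n) \<longlonglongrightarrow> moment j i"

text \<open>
  Both sides satisfy the recursion obtained by expanding one factor \<open>2 + N\<close>.
\<close>

lemma trace_limit_shift:
  assumes "\<And>i. i \<le> K \<Longrightarrow> trace_limit 0 i"
  shows "j + i \<le> K \<Longrightarrow> trace_limit j i"
proof (induction j arbitrary: i)
  case 0
  then show ?case using assms by simp
next
  case (Suc j)
  have eq: "(2 + X.N n) ^ Suc j * X.N n ^ i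
      = (2 + X.N n) ^ j * X.N n ^ i + (2 + X.N n) ^ j * X.N n ^ i + (2 + X.N n) ^ j * X.N n ^ Suc i" for n
  proof -
    have "(2 + X.N n) ^ Suc j * X.N n ^ i = (2 + X.N n) ^ j * ((2 + X.N n) * X.N n ^ i)"
      by (simp only: power_Suc2 mult.assoc)
    also have "(2 + X.N n) * X.N n ^ i = X.N n ^ i + X.N n ^ i + X.N n ^ Suc i"
      by (simp add: distrib_right mult_2)
    finally show ?thesis by (simp only: distrib_left)
  qed
  have "(\<lambda>n. 2 * (trace_on (X n) ((2 + X.N n) ^ j * X.N n ^ i) / num_simplices n)
      + trace_on (X n) ((2 + X.N n) ^ j * X.N n ^ Suc i) / num_simplices n) \<longlonglongrightarrow> 2 * moment j i + moment j (Suc i)"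
    using Suc.IH[of i] Suc.IH[of "Suc i"] Suc.prems unfolding trace_limit_def
    by (intro tendsto_intros) auto
  then show ?case
    unfolding trace_limit_def moment_Suc eq trace_on_simps
    by (rule back_subst[where P = "\<lambda>h. h \<longlonglongrightarrow> _"]) (auto simp: fun_eq_iff add_divide_distrib)
qed

text \<open>
  A moment of order \<open>2 (l + 1)\<close> of a refinement is, up to a bounded error, a combination of moments of
  order at most \<open>l + 1\<close> one level below.
\<close>

lemma trace_limit_even:
  assumes "trace_limit (Suc l) 0"
  shows "trace_limit 0 (2 * Suc l)"
proof -
  define C where "C = 2 * (real (Suc l) * (max_inc + max_inc) ^ l * X.defect 0)"
  let ?t = "\<lambda>n. trace_on (X n) (X.N n ^ (2 * Suc l))"
  let ?s = "\<lambda>n. trace_on (X n) ((2 + X.N n) ^ Suc l)"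
  have est: "\<bar>?t (Suc n) - 2 * ?s n\<bar> \<le> C" for n
    unfolding C_def X_Suc defect_eq[symmetric, of n]
    by (rule X.trace_refinement_estimate[OF incidences_le]) (auto simp: max_inc_def)
  have "(\<lambda>n. (?t (Suc n) - 2 * ?s n) / num_simplices (Suc n)) \<longlonglongrightarrow> 0"
  proof (rule Lim_null_comparison)
    show "\<forall>\<^sub>F n in sequentially. norm ((?t (Suc n) - 2 * ?s n) / num_simplices (Suc n)) \<le> C / num_simplices (Suc n)"
      using est size_pos by (auto simp: divide_right_mono less_imp_le)
    show "(\<lambda>n. C / num_simplices (Suc n)) \<longlonglongrightarrow> 0" by (rule LIMSEQ_Suc[OF const_over_size])
  qed
  moreover have "(\<lambda>n. (2 * num_simplices n / num_simplices (Suc n)) * (?s n / num_simplices n)) \<longlonglongrightarrow> 1 * moment (Suc l) 0"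
    using assms unfolding trace_limit_def by (intro tendsto_mult size_ratio) simp
  ultimately have "(\<lambda>n. (?t (Suc n) - 2 * ?s n) / num_simplices (Suc n)
      + (2 * num_simplices n / num_simplices (Suc n)) * (?s n / num_simplices n)) \<longlonglongrightarrow> 0 + 1 * moment (Suc l) 0"
    by (rule tendsto_add)
  moreover have "(?t (Suc n) - 2 * ?s n) / num_simplices (Suc n) + (2 * num_simplices n / num_simplices (Suc n)) * (?s n / num_simplices n)
      = ?t (Suc n) / num_simplices (Suc n)" for n
    using size_pos[of n] size_pos[of "Suc n"] by (simp add: field_simps)
  ultimately have "(\<lambda>n. ?t (Suc n) / num_simplices (Suc n)) \<longlonglongrightarrow> moment (Suc l) 0"
    by (simp only: add_0 mult_1)
  then have "(\<lambda>n. ?t n / num_simplices n) \<longlonglongrightarrow> moment 0 (2 * Suc l)"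
    unfolding moment_0_even by (rule LIMSEQ_imp_Suc)
  then show ?thesis by (simp only: trace_limit_def power_0 mult_1)
qed

text \<open>
  The induction is well founded because passing one level down halves the order of the moment.
\<close>

lemma trace_limit_0: "trace_limit 0 i"
proof (induction i rule: less_induct)
  case (less i)
  consider "i = 0" | l where "i = Suc (2 * l)" | l where "i = 2 * Suc l"
    by (metis oddE evenE Suc_eq_plus1 not0_implies_Suc mult_0_right)
  then show ?case
  proof cases
    case 1
    have "num_simplices n \<noteq> 0" for n using size_pos[of n] by simp
    then show ?thesis using 1 by (simp add: trace_limit_def moment_0_0 flip: num_simplices_def)
  next
    case 2
    then show ?thesis
      by (simp only: trace_limit_def power_0 mult_1 X.trace_hasse_odd moment_0_odd) simp
  next
    case 3
    have "trace_limit (Suc l) 0"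
      by (rule trace_limit_shift[of "Suc l"]) (use less 3 in auto)
    then show ?thesis unfolding 3 by (rule trace_limit_even)
  qed
qed

lemma hasse_moments:
  "(\<lambda>n. trace_on (X n) (X.N n ^ (2 * j)) / num_simplices n) \<longlonglongrightarrow> moment j 0"
  using trace_limit_0[of "2 * j"] by (simp add: trace_limit_def moment_0_even)

lemma connection_moments:
  "(\<lambda>n. trace_on (X n) (X.N n ^ (2 * j) * connection (X n) ^ m) / num_simplices n) \<longlonglongrightarrow> branch_moment j m"
proof (induction m arbitrary: j rule: induct_nat_012)
  case 0
  then show ?case using hasse_moments by (simp add: branch_moment_0)
next
  case 1
  have "(\<lambda>n. (of_bool (j = 0) * euler) / num_simplices n + trace_on (X n) (X.N n ^ (2 * Suc j)) / num_simplices n / 2)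
      \<longlonglongrightarrow> 0 + moment (Suc j) 0 / 2"
    by (intro tendsto_intros const_over_size hasse_moments) simp
  moreover have "trace_on (X n) (X.N n ^ (2 * j) * connection (X n) ^ Suc 0) / num_simplices n
      = (of_bool (j = 0) * euler) / num_simplices n + trace_on (X n) (X.N n ^ (2 * Suc j)) / num_simplices n / 2" for n
    using X.trace_hasse_connection[of n j] by (simp add: euler_eq add_divide_distrib)
  ultimately show ?case using branch_moment_1[of j] by (simp only: add_0 One_nat_def)
next
  case (ge2 m)
  have "(\<lambda>n. trace_on (X n) (X.N n ^ (2 * Suc j) * connection (X n) ^ Suc m) / num_simplices n
      + trace_on (X n) (X.N n ^ (2 * j) * connection (X n) ^ m) / num_simplices n)
      \<longlonglongrightarrow> branch_moment (Suc j) (Suc m) + branch_moment j m"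
    by (intro tendsto_add ge2)
  then show ?case
    unfolding X.trace_connection_step branch_moment_step add_divide_distrib .
qed

end

section \<open>The spectrum of the connection Laplacian\<close>

definition apply_on :: "'v set \<Rightarrow> 'v kernel \<Rightarrow> ('v \<Rightarrow> real) \<Rightarrow> 'v \<Rightarrow> real" where
  "apply_on X A u x = (\<Sum>y\<in>X. entry A x y * u y)"

lemma apply_on_cong: "(\<And>y. y \<in> X \<Longrightarrow> u y = v y) \<Longrightarrow> apply_on X A u x = apply_on X A v x"
  by (simp add: apply_on_def)

lemma apply_on_mult:
  assumes "finite X" "block X A" "x \<in> X"
  shows "apply_on X (A * B) u x = apply_on X A (apply_on X B u) x"
proof -
  have "apply_on X (A * B) u x = (\<Sum>y\<in>X. \<Sum>z\<in>X. entry A x z * entry B z y * u y)"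
    by (simp add: apply_on_def entry_mult_block[OF assms] sum_distrib_right)
  also have "\<dots> = (\<Sum>z\<in>X. \<Sum>y\<in>X. entry A x z * entry B z y * u y)"
    by (rule sum.swap)
  finally show ?thesis by (simp add: apply_on_def sum_distrib_left mult.assoc)
qed

text \<open>
  Evaluate the eigenvalue equation where the eigenvector has the largest absolute value.
\<close>

lemma eigenvalue_le_row_bound:
  assumes X: "finite X" and A: "row_bounded X M A"
    and u: "\<And>x. x \<in> X \<Longrightarrow> apply_on X A u x = l * u x" and nz: "\<exists>x\<in>X. u x \<noteq> 0"
  shows "\<bar>l\<bar> \<le> M"
proof -
  define m where "m = Max ((\<lambda>x. \<bar>u x\<bar>) ` X)"
  obtain x where x: "x \<in> X" "\<bar>u x\<bar> = m"
    using nz X Max_in[of "(\<lambda>x. \<bar>u x\<bar>) ` X"] unfolding m_def by fastforce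
  have le: "\<bar>u y\<bar> \<le> m" if "y \<in> X" for y
    using that X by (simp add: m_def)
  have "m > 0"
  proof -
    obtain y where "y \<in> X" "u y \<noteq> 0" using nz by blast
    then show ?thesis using le[of y] by simp
  qed
  have "\<bar>l\<bar> * m = \<bar>apply_on X A u x\<bar>" using u[OF x(1)] x(2) by (simp add: abs_mult)
  also have "\<dots> \<le> (\<Sum>y\<in>X. \<bar>entry A x y * u y\<bar>)" unfolding apply_on_def by (rule sum_abs)
  also have "\<dots> \<le> (\<Sum>y\<in>X. \<bar>entry A x y\<bar> * m)"
    unfolding abs_mult by (intro sum_mono mult_left_mono le) auto
  also have "\<dots> = (\<Sum>y\<in>X. \<bar>entry A x y\<bar>) * m" by (simp only: sum_distrib_right)
  also have "\<dots> \<le> M * m"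
    by (rule mult_right_mono) (use row_boundedD[OF A x(1)] \<open>m > 0\<close> in auto)
  finally show ?thesis using \<open>m > 0\<close> by simp
qed

context graph_complex
begin

lemma inverse_mult_connection: "(connection G - N * N) * connection G = projection G"
  by (simp add: left_diff_distrib connection_square)

lemma apply_projection: "x \<in> G \<Longrightarrow> apply_on G (projection G) u x = u x"
proof -
  assume x: "x \<in> G"
  have "apply_on G (projection G) u x = (\<Sum>y\<in>G. if x = y then u x else 0)"
    unfolding apply_on_def by (rule sum.cong) (use x in auto)
  then show ?thesis using x by simp
qed

lemma apply_inverse_connection:
  "x \<in> G \<Longrightarrow> apply_on G (connection G - N * N) (apply_on G (connection G) u) x = u x"
  by (subst apply_on_mult[symmetric]) (simp_all add: inverse_mult_connection apply_projection)

lemma entry_connection_sym: "entry (connection G) x y = entry (connection G) y x"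
  by (auto simp: connection_def Int_commute)

text \<open>
  The bound from above is the row bound of \<open>L\<^sup>2\<close>, the one for the reciprocal that of \<open>(L - N\<^sup>2)\<^sup>2 = L\<^sup>-\<^sup>2\<close>.
  Positivity comes from \<open>l |u|\<^sup>2 = |L u|\<^sup>2\<close>.
\<close>

lemma connection_square_eigenvalue_bounds:
  assumes L: "row_bounded G M (connection G)" and K: "row_bounded G M (connection G - N * N)"
    and M: "0 \<le> M"
    and u: "\<And>x. x \<in> G \<Longrightarrow> apply_on G (connection G * connection G) u x = l * u x"
    and nz: "\<exists>x\<in>G. u x \<noteq> 0"
  shows "0 < l" "l \<le> M\<^sup>2" "inverse l \<le> M\<^sup>2"
proof -
  let ?L = "connection G" and ?K = "connection G - N * N"
  have LL: "apply_on G ?L (apply_on G ?L u) x = l * u x" if "x \<in> G" for x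
    using u[OF that] that by (simp add: apply_on_mult)
  have "\<bar>l\<bar> \<le> M * M"
    by (rule eigenvalue_le_row_bound[OF finite_G row_bounded_mult[OF _ _ L L M] u nz]) auto
  then show "l \<le> M\<^sup>2" by (simp add: power2_eq_square)
  have KK: "apply_on G (?K * ?K) (\<lambda>x. l * u x) x = u x" if x: "x \<in> G" for x
  proof -
    have "apply_on G (?K * ?K) (\<lambda>x. l * u x) x = apply_on G ?K (apply_on G ?K (\<lambda>x. l * u x)) x"
      using x by (intro apply_on_mult) auto
    also have "\<dots> = apply_on G ?K (apply_on G ?K (apply_on G ?L (apply_on G ?L u))) x"
      by (intro apply_on_cong) (simp add: apply_on_def LL[unfolded apply_on_def])
    also have "\<dots> = apply_on G ?K (apply_on G ?L u) x"
      by (intro apply_on_cong apply_inverse_connection)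
    also have "\<dots> = u x" by (rule apply_inverse_connection[OF x])
    finally show ?thesis .
  qed
  have "l \<noteq> 0"
  proof
    assume "l = 0"
    then have "u x = 0" if "x \<in> G" for x using KK[OF that] by (simp add: apply_on_def)
    then show False using nz by blast
  qed
  have "\<bar>inverse l\<bar> \<le> M * M"
  proof (rule eigenvalue_le_row_bound[OF finite_G row_bounded_mult[OF _ _ K K M] _ nz])
    fix x assume "x \<in> G"
    from KK[OF this] have "l * apply_on G (?K * ?K) u x = u x"
      by (simp add: apply_on_def sum_distrib_left mult_ac)
    then show "apply_on G (?K * ?K) u x = inverse l * u x"
      using \<open>l \<noteq> 0\<close> by (simp add: field_simps)
  qed auto
  then show "inverse l \<le> M\<^sup>2"
    unfolding power2_eq_square using abs_ge_self[of "inverse l"] by (rule order.trans[rotated])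
  have "0 \<le> (\<Sum>y\<in>G. (apply_on G ?L u y)\<^sup>2)" by (simp add: sum_nonneg)
  also have "\<dots> = (\<Sum>y\<in>G. \<Sum>x\<in>G. u x * (entry ?L x y * apply_on G ?L u y))"
  proof (rule sum.cong)
    fix y assume "y \<in> G"
    have "apply_on G ?L u y = (\<Sum>x\<in>G. entry ?L x y * u x)"
      unfolding apply_on_def by (simp only: entry_connection_sym[of y])
    then show "(apply_on G ?L u y)\<^sup>2 = (\<Sum>x\<in>G. u x * (entry ?L x y * apply_on G ?L u y))"
      by (simp only: power2_eq_square sum_distrib_right mult_ac)
  qed simp
  also have "\<dots> = (\<Sum>x\<in>G. u x * apply_on G ?L (apply_on G ?L u) x)"
    by (subst sum.swap) (simp only: apply_on_def sum_distrib_left)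
  also have "\<dots> = l * (\<Sum>x\<in>G. (u x)\<^sup>2)"
    by (simp add: LL sum_distrib_left power2_eq_square mult_ac)
  finally have "0 \<le> l * (\<Sum>x\<in>G. (u x)\<^sup>2)" .
  moreover have "0 < (\<Sum>x\<in>G. (u x)\<^sup>2)"
  proof -
    obtain x where "x \<in> G" "u x \<noteq> 0" using nz by blast
    then show ?thesis by (intro sum_pos2[of _ x]) auto
  qed
  ultimately show "0 < l" using \<open>l \<noteq> 0\<close> by (simp add: zero_le_mult_iff)
qed

text \<open>
  The enumeration of simplices is the one used by \<open>connection_laplacian\<close>; sums over indices
  become sums over simplices, in which the enumeration is no longer visible.
\<close>

definition kernel_mat :: "'v set kernel \<Rightarrow> real mat" where
  "kernel_mat A = mat (card G) (card G) (\<lambda>(i, j). entry A (simplex_list G ! i) (simplex_list G ! j))"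

lemma kernel_mat_carrier [simp]: "kernel_mat A \<in> carrier_mat (card G) (card G)"
  by (simp add: kernel_mat_def)

lemma bij_simplex_list: "bij_betw (nth (simplex_list G)) {..<card G} G"
proof -
  note sl = simplex_list[OF finite_G]
  have "length (simplex_list G) = card G" using distinct_card[OF sl(1)] sl(2) by simp
  then show ?thesis using bij_betw_nth[OF sl(1), of "{..<card G}" G] sl(2) by simp
qed

lemma simplex_list_mem: "i < card G \<Longrightarrow> simplex_list G ! i \<in> G"
  using bij_betwE[OF bij_simplex_list] by simp

lemma sum_simplex_list: "(\<Sum>i<card G. g (simplex_list G ! i)) = (\<Sum>x\<in>G. g x)"
  by (rule sum.reindex_bij_betw[OF bij_simplex_list])

lemma simplex_list_eq_iff:
  "i < card G \<Longrightarrow> j < card G \<Longrightarrow> simplex_list G ! i = simplex_list G ! j \<longleftrightarrow> i = j"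
  using bij_betw_imp_inj_on[OF bij_simplex_list] by (auto simp: inj_on_def)

lemma kernel_mat_one: "kernel_mat 1 = 1\<^sub>m (card G)"
  by (rule eq_matI) (auto simp: kernel_mat_def simplex_list_eq_iff)

lemma kernel_mat_mult:
  assumes "block G A"
  shows "kernel_mat (A * B) = kernel_mat A * kernel_mat B"
proof (rule eq_matI)
  fix i j assume "i < dim_row (kernel_mat A * kernel_mat B)" "j < dim_col (kernel_mat A * kernel_mat B)"
  then have ij: "i < card G" "j < card G" by (simp_all add: kernel_mat_def)
  have "(kernel_mat A * kernel_mat B) $$ (i, j)
      = (\<Sum>k<card G. entry A (simplex_list G ! i) (simplex_list G ! k)
          * entry B (simplex_list G ! k) (simplex_list G ! j))"
    using ij by (simp add: kernel_mat_def scalar_prod_def atLeast0LessThan)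
  also have "\<dots> = entry (A * B) (simplex_list G ! i) (simplex_list G ! j)"
    unfolding entry_mult_block[OF finite_G assms simplex_list_mem[OF ij(1)]] by (rule sum_simplex_list)
  finally show "kernel_mat (A * B) $$ (i, j) = (kernel_mat A * kernel_mat B) $$ (i, j)"
    using ij by (simp add: kernel_mat_def)
qed (simp_all add: kernel_mat_def)

lemma kernel_mat_power: "block G A \<Longrightarrow> kernel_mat (A ^ k) = kernel_mat A ^\<^sub>m k"
proof (induction k)
  case 0
  have "dim_row (kernel_mat A) = card G" by (simp add: kernel_mat_def)
  then show ?case by (simp add: kernel_mat_one)
next
  case (Suc k)
  then show ?case
    using kernel_mat_mult[of "A ^ k" A] by (simp only: power_Suc2 pow_mat.simps block_power)
qed

lemma mat_trace_kernel_mat: "mat_trace (kernel_mat A) = trace_on G A"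
proof -
  have "mat_trace (kernel_mat A) = (\<Sum>i<card G. entry A (simplex_list G ! i) (simplex_list G ! i))"
    by (simp add: mat_trace_def kernel_mat_def)
  also have "\<dots> = trace_on G A"
    unfolding trace_on_def by (rule sum_simplex_list[of "\<lambda>x. entry A x x"])
  finally show ?thesis .
qed

lemma connection_laplacian_eq: "connection_laplacian G = kernel_mat (connection G)"
proof (rule eq_matI)
  fix i j assume "i < dim_row (kernel_mat (connection G))" "j < dim_col (kernel_mat (connection G))"
  then have ij: "i < card G" "j < card G" by (simp_all add: kernel_mat_def)
  then show "connection_laplacian G $$ (i, j) = kernel_mat (connection G) $$ (i, j)"
    using simplex_list_mem by (simp add: connection_laplacian_def kernel_mat_def connection_def)
qed (simp_all add: connection_laplacian_def kernel_mat_def)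

abbreviation spectrum :: "real multiset" where
  "spectrum \<equiv> eigenvalues (connection_laplacian G * connection_laplacian G)"

lemma laplacian_square_eq:
  "connection_laplacian G * connection_laplacian G = kernel_mat (connection G * connection G)"
  by (simp add: connection_laplacian_eq kernel_mat_mult)

lemma entry_connection_square_sym:
  "x \<in> G \<Longrightarrow> y \<in> G \<Longrightarrow> entry (connection G * connection G) x y = entry (connection G * connection G) y x"
  by (simp add: entry_mult_block[OF finite_G] entry_connection_sym[of y] mult.commute)
     (simp add: entry_connection_sym[of _ x] mult.commute)

lemma spectrum_power_sum: "(\<Sum>l\<in>#spectrum. l ^ k) = trace_on G (connection G ^ (2 * k))"
proof -
  have "(\<Sum>l\<in>#spectrum. l ^ k) = mat_trace (kernel_mat (connection G * connection G) ^\<^sub>m k)"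
    unfolding laplacian_square_eq
  proof (rule symmetric_eigenvalues_power_sum)
    fix i j assume "i < card G" "j < card G"
    then show "kernel_mat (connection G * connection G) $$ (i, j)
        = kernel_mat (connection G * connection G) $$ (j, i)"
      using entry_connection_square_sym simplex_list_mem by (simp add: kernel_mat_def)
  qed simp
  also have "\<dots> = trace_on G ((connection G * connection G) ^ k)"
    by (simp flip: kernel_mat_power add: mat_trace_kernel_mat)
  finally show ?thesis by (simp only: power_mult power2_eq_square)
qed

lemma size_spectrum: "size spectrum = card G"
  using spectrum_power_sum[of 0] by simp

lemma spectrum_bounds:
  assumes L: "row_bounded G M (connection G)" and K: "row_bounded G M (connection G - N * N)"
    and M: "0 \<le> M" and l: "l \<in># spectrum"
  shows "0 < l" "l \<le> M\<^sup>2" "inverse l \<le> M\<^sup>2"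
proof -
  let ?A = "kernel_mat (connection G * connection G)"
  have "poly (char_poly ?A) l = 0"
  proof -
    have "char_poly ?A \<noteq> 0" using degree_monic_char_poly[of ?A "card G"] by auto
    then show ?thesis using l by (simp add: laplacian_square_eq eigenvalues_def)
  qed
  then obtain v where v: "\<exists>i<card G. v i \<noteq> 0"
    "\<And>i. i < card G \<Longrightarrow> (\<Sum>j<card G. ?A $$ (i, j) * v j) = l * v i"
    using eigenvector_function[of ?A "card G" l] by auto
  define u where "u x = v (the_inv_into {..<card G} (nth (simplex_list G)) x)" for x
  have uv: "u (simplex_list G ! i) = v i" if "i < card G" for i
    using that bij_betw_imp_inj_on[OF bij_simplex_list] by (simp add: u_def the_inv_into_f_f)
  have "apply_on G (connection G * connection G) u x = l * u x" if x: "x \<in> G" for x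
  proof -
    obtain i where i: "i < card G" "x = simplex_list G ! i"
      using x bij_betw_imp_surj_on[OF bij_simplex_list] by blast
    have "apply_on G (connection G * connection G) u x
        = (\<Sum>j<card G. entry (connection G * connection G) x (simplex_list G ! j) * u (simplex_list G ! j))"
      unfolding apply_on_def by (rule sum_simplex_list[symmetric])
    also have "\<dots> = (\<Sum>j<card G. ?A $$ (i, j) * v j)"
      using i by (intro sum.cong) (simp_all add: uv kernel_mat_def)
    finally show ?thesis using v(2)[OF i(1)] uv[OF i(1)] i(2) by simp
  qed
  moreover have "\<exists>x\<in>G. u x \<noteq> 0" using v(1) uv simplex_list_mem by metis
  ultimately show "0 < l" "l \<le> M\<^sup>2" "inverse l \<le> M\<^sup>2"
    using connection_square_eigenvalue_bounds[OF L K M] by blast+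
qed

end

section \<open>From moments to continuous functions, and uniformity\<close>

lemma abs_sum_mset_diff_le:
  fixes f g :: "'b \<Rightarrow> real"
  assumes "\<And>l. l \<in># S \<Longrightarrow> \<bar>f l - g l\<bar> \<le> d"
  shows "\<bar>(\<Sum>l\<in>#S. f l) - (\<Sum>l\<in>#S. g l)\<bar> \<le> real (size S) * d"
  using assms
proof (induction S)
  case (add x S)
  have "\<bar>f x - g x\<bar> \<le> d" "\<bar>(\<Sum>l\<in>#S. f l) - (\<Sum>l\<in>#S. g l)\<bar> \<le> real (size S) * d"
    using add by auto
  then show ?case by (simp add: algebra_simps abs_le_iff)
qed simp

text \<open>
  On a fixed compact interval, polynomials are uniformly dense in the continuous functions, so the
  convergence of all moments implies that of all continuous averages. The limit measure is
  the average of the push-forwards of the uniform measure by \<open>p\<close> and \<open>q\<close>.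
\<close>

lemma weierstrass_moment_method:
  fixes S :: "nat \<Rightarrow> real multiset" and p q f :: "real \<Rightarrow> real"
  assumes S: "\<And>n l. l \<in># S n \<Longrightarrow> l \<in> {a..b}" "\<And>n. S n \<noteq> {#}"
    and p: "continuous_on {0..1} p" "\<And>x. x \<in> {0..1} \<Longrightarrow> p x \<in> {a..b}"
    and q: "continuous_on {0..1} q" "\<And>x. x \<in> {0..1} \<Longrightarrow> q x \<in> {a..b}"
    and mom: "\<And>k. (\<lambda>n. (\<Sum>l\<in>#S n. l ^ k) / size (S n)) \<longlonglongrightarrow> integral {0..1} (\<lambda>x. (p x ^ k + q x ^ k) / 2)"
    and f: "continuous_on {a..b} f"
  shows "(\<lambda>n. (\<Sum>l\<in>#S n. f l) / size (S n)) \<longlonglongrightarrow> integral {0..1} (\<lambda>x. (f (p x) + f (q x)) / 2)"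
proof (rule tendstoI)
  fix \<epsilon> :: real assume \<epsilon>: "\<epsilon> > 0"
  have im: "p ` {0..1} \<subseteq> {a..b}" "q ` {0..1} \<subseteq> {a..b}" using p(2) q(2) by blast+
  have comp: "continuous_on {0..1} (\<lambda>x. g (p x))" "continuous_on {0..1} (\<lambda>x. g (q x))"
    if "continuous_on {a..b} g" for g :: "real \<Rightarrow> real"
    by (rule continuous_on_compose2[OF that p(1) im(1)], rule continuous_on_compose2[OF that q(1) im(2)])
  have int: "(\<lambda>x. (g (p x) + g (q x)) / 2) integrable_on {0..1}"
    if "continuous_on {a..b} g" for g :: "real \<Rightarrow> real"
    by (intro integrable_continuous_real continuous_on_divide continuous_on_add
        continuous_on_const comp[OF that]) simp
  have \<epsilon>3: "0 < \<epsilon> / 3" using \<epsilon> by simp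
  obtain g where g: "real_polynomial_function g" "\<And>x. x \<in> {a..b} \<Longrightarrow> \<bar>f x - g x\<bar> < \<epsilon> / 3"
  proof -
    show ?thesis
      by (rule Stone_Weierstrass_real_polynomial_function[OF compact_Icc f \<epsilon>3]) (rule that)
  qed
  obtain c N where gc: "g = (\<lambda>x. \<Sum>i\<le>N. c i * x ^ i)"
    using g(1) unfolding real_polynomial_function_iff_sum by (elim exE)
  have g_cont: "continuous_on {a..b} g" unfolding gc by (intro continuous_intros)
  have mono_cont: "continuous_on {a..b} (\<lambda>x. x ^ k)" for k :: nat by (intro continuous_intros)
  have poly: "(\<lambda>n. (\<Sum>l\<in>#S n. \<Sum>i\<le>N. c i * l ^ i) / size (S n))
      \<longlonglongrightarrow> integral {0..1} (\<lambda>x. ((\<Sum>i\<le>N. c i * p x ^ i) + (\<Sum>i\<le>N. c i * q x ^ i)) / 2)" for N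
  proof -
    have "(\<lambda>n. \<Sum>i\<le>N. c i * ((\<Sum>l\<in>#S n. l ^ i) / size (S n)))
        \<longlonglongrightarrow> (\<Sum>i\<le>N. c i * integral {0..1} (\<lambda>x. (p x ^ i + q x ^ i) / 2))"
      by (intro tendsto_intros mom)
    moreover have "(\<Sum>i\<le>N. c i * ((\<Sum>l\<in>#S n. l ^ i) / size (S n)))
        = (\<Sum>l\<in>#S n. \<Sum>i\<le>N. c i * l ^ i) / size (S n)" for n
    proof -
      have "(\<Sum>i\<le>N. c i * (\<Sum>l\<in>#S n. l ^ i)) = (\<Sum>l\<in>#S n. \<Sum>i\<le>N. c i * l ^ i)"
        by (induction N) (simp_all add: sum_mset.distrib sum_mset_distrib_left
            image_mset.compositionality o_def)
      then show ?thesis by (simp flip: sum_divide_distrib)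
    qed
    moreover have "(\<Sum>i\<le>N. c i * integral {0..1} (\<lambda>x. (p x ^ i + q x ^ i) / 2))
        = integral {0..1} (\<lambda>x. ((\<Sum>i\<le>N. c i * p x ^ i) + (\<Sum>i\<le>N. c i * q x ^ i)) / 2)"
    proof -
      have "integral {0..1} (\<lambda>x. \<Sum>i\<le>N. c i * ((p x ^ i + q x ^ i) / 2))
          = (\<Sum>i\<le>N. integral {0..1} (\<lambda>x. c i * ((p x ^ i + q x ^ i) / 2)))"
      proof (intro integral_sum finite_atMost)
        show "(\<lambda>x. c i * ((p x ^ i + q x ^ i) / 2)) integrable_on {0..1}" for i
          using integrable_cmul[OF int[OF mono_cont], of "c i"] by (simp only: real_scaleR_def)
      qed
      also have "\<dots> = (\<Sum>i\<le>N. c i * integral {0..1} (\<lambda>x. (p x ^ i + q x ^ i) / 2))"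
        by (simp only: integral_mult_right)
      also have "(\<lambda>x. \<Sum>i\<le>N. c i * ((p x ^ i + q x ^ i) / 2))
          = (\<lambda>x. ((\<Sum>i\<le>N. c i * p x ^ i) + (\<Sum>i\<le>N. c i * q x ^ i)) / 2)"
        unfolding sum.distrib[symmetric] sum_divide_distrib
        by (intro ext sum.cong) (simp_all add: distrib_left)
      finally show ?thesis by simp
    qed
    ultimately show ?thesis by (simp only:)
  qed
  have mean_close: "\<bar>(u + v) / 2 - (w + z) / 2\<bar> \<le> e" if "\<bar>u - w\<bar> < e" "\<bar>v - z\<bar> < e"
    for u v w z e :: real
    using that by (simp add: abs_if field_simps split: if_splits)
  let ?I = "\<lambda>h. integral {0..1} (\<lambda>x. (h (p x) + h (q x)) / 2)"
  have I: "\<bar>?I f - ?I g\<bar> \<le> \<epsilon> / 3"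
  proof -
    have "?I f - ?I g = integral {0..1} (\<lambda>x. (f (p x) + f (q x)) / 2 - (g (p x) + g (q x)) / 2)"
      by (rule integral_diff[symmetric]) (rule int, fact)+
    also have "norm \<dots> \<le> \<epsilon> / 3 * (1 - 0)"
    proof (rule integral_bound)
      show "continuous_on {0..1} (\<lambda>x. (f (p x) + f (q x)) / 2 - (g (p x) + g (q x)) / 2)"
        by (intro continuous_on_diff continuous_on_divide continuous_on_add continuous_on_const
            comp[OF f] comp[OF g_cont]) simp_all
      fix x :: real assume x: "x \<in> {0..1}"
      show "norm ((f (p x) + f (q x)) / 2 - (g (p x) + g (q x)) / 2) \<le> \<epsilon> / 3"
        unfolding real_norm_def by (rule mean_close) (rule g(2)[OF p(2)[OF x]], rule g(2)[OF q(2)[OF x]])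
    qed simp
    finally show ?thesis by simp
  qed
  have avg: "\<bar>(\<Sum>l\<in>#S n. f l) / size (S n) - (\<Sum>l\<in>#S n. g l) / size (S n)\<bar> \<le> \<epsilon> / 3" for n
  proof -
    have "\<bar>(\<Sum>l\<in>#S n. f l) - (\<Sum>l\<in>#S n. g l)\<bar> \<le> real (size (S n)) * (\<epsilon> / 3)"
      by (rule abs_sum_mset_diff_le) (use g(2) S(1) less_imp_le in blast)
    moreover have "real (size (S n)) > 0" using S(2)[of n] by (simp add: size_eq_0_iff_empty zero_less_iff_neq_zero)
    ultimately show ?thesis
      by (simp add: diff_divide_distrib[symmetric] abs_divide pos_divide_le_eq mult.commute)
  qed
  have "\<forall>\<^sub>F n in sequentially. dist ((\<Sum>l\<in>#S n. g l) / size (S n)) (?I g) < \<epsilon> / 3"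
    using tendstoD[OF poly[of N], of "\<epsilon> / 3"] \<epsilon> by (simp add: gc)
  then show "\<forall>\<^sub>F n in sequentially. dist ((\<Sum>l\<in>#S n. f l) / size (S n)) (?I f) < \<epsilon>"
  proof (rule eventually_mono)
    fix n
    let ?f = "(\<Sum>l\<in>#S n. f l) / size (S n)" and ?g = "(\<Sum>l\<in>#S n. g l) / size (S n)"
    assume "dist ?g (?I g) < \<epsilon> / 3"
    moreover have "dist ?f ?g \<le> \<epsilon> / 3" "dist (?I g) (?I f) \<le> \<epsilon> / 3"
      using avg[of n] I by (simp_all only: dist_real_def abs_minus_commute)
    moreover have "dist ?f (?I f) \<le> dist ?f ?g + dist ?g (?I g) + dist (?I g) (?I f)"
      using dist_triangle[of ?f "?I f" ?g] dist_triangle[of ?g "?I f" "?I g"] by linarith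
    ultimately show "dist ?f (?I f) < \<epsilon>" by linarith
  qed
qed

text \<open>
  The limit inherits the Lipschitz constant, and pointwise convergence on a finite net suffices.
\<close>

lemma uniform_limit_lipschitz:
  fixes F :: "nat \<Rightarrow> 'b :: metric_space \<Rightarrow> 'c :: metric_space"
  assumes K: "compact K" and C: "0 \<le> C"
    and lip: "\<And>n x y. x \<in> K \<Longrightarrow> y \<in> K \<Longrightarrow> dist (F n x) (F n y) \<le> C * dist x y"
    and lim: "\<And>x. x \<in> K \<Longrightarrow> (\<lambda>n. F n x) \<longlonglongrightarrow> G x"
  shows "uniform_limit K F G sequentially"
proof (rule uniform_limitI)
  fix \<epsilon> :: real assume \<epsilon>: "\<epsilon> > 0"
  have lipG: "dist (G x) (G y) \<le> C * dist x y" if "x \<in> K" "y \<in> K" for x y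
    by (rule tendsto_upperbound[OF tendsto_dist[OF lim[OF that(1)] lim[OF that(2)]]])
       (use lip[OF that] in auto)
  (* a net this fine contributes at most a third of \<epsilon> twice, once for F n and once for G *)
  define d where "d = \<epsilon> / (3 * (C + 1))"
  have d: "d > 0" using \<epsilon> C by (simp add: d_def)
  have Cd: "C * t \<le> \<epsilon> / 3" if "t < d" "0 \<le> t" for t
  proof -
    have "C * t \<le> (C + 1) * d" using that C by (intro mult_mono) auto
    also have "\<dots> = \<epsilon> / 3" using C by (simp add: d_def field_simps)
    finally show ?thesis .
  qed
  obtain T where T: "finite T" "T \<subseteq> K" "K \<subseteq> (\<Union>x\<in>T. ball x d)"
    using compactE_image[OF K, of K "\<lambda>x. ball x d"] d by (metis UN_I centre_in_ball open_ball subsetI)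
  have "\<forall>\<^sub>F n in sequentially. \<forall>x\<in>T. dist (F n x) (G x) < \<epsilon> / 3"
    using T(1,2) tendstoD[OF lim, of _ "\<epsilon> / 3"] \<epsilon> by (intro eventually_ball_finite) auto
  then show "\<forall>\<^sub>F n in sequentially. \<forall>x\<in>K. dist (F n x) (G x) < \<epsilon>"
  proof (rule eventually_mono, intro ballI)
    fix n x assume n: "\<forall>x\<in>T. dist (F n x) (G x) < \<epsilon> / 3" and x: "x \<in> K"
    obtain y where y: "y \<in> T" "dist y x < d" using T(3) x by auto
    then have yK: "y \<in> K" using T(2) by blast
    have "dist (F n x) (F n y) \<le> \<epsilon> / 3" "dist (G y) (G x) \<le> \<epsilon> / 3"
      using lip[OF x yK, of n] lipG[OF yK x] Cd[of "dist y x"] y(2) by (auto simp: dist_commute)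
    moreover have "dist (F n y) (G y) < \<epsilon> / 3" using n y(1) by blast
    moreover have "dist (F n x) (G x) \<le> dist (F n x) (F n y) + dist (F n y) (G y) + dist (G y) (G x)"
      using dist_triangle[of "F n x" "G x" "F n y"] dist_triangle[of "F n y" "G x" "G y"] by linarith
    ultimately show "dist (F n x) (G x) < \<epsilon>" by linarith
  qed
qed

lemma powr_lipschitz:
  assumes l: "0 < l" "\<bar>ln l\<bar> \<le> \<Lambda>" and st: "cmod s \<le> r" "cmod t \<le> r"
  shows "cmod (complex_of_real l powr (- s) - complex_of_real l powr (- t)) \<le> \<Lambda> * exp (r * \<Lambda>) * cmod (s - t)"
proof -
  have r: "0 \<le> r" using st(1) norm_ge_zero[of s] by linarith
  let ?f = "\<lambda>s. exp (- s * complex_of_real (ln l))"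
  have powr: "complex_of_real l powr (- s) = ?f s" for s
    using l(1) by (simp add: powr_def Ln_of_real)
  have "cmod (?f s - ?f t) \<le> \<Lambda> * exp (r * \<Lambda>) * cmod (s - t)"
  proof (rule field_differentiable_bound[OF convex_cball[of 0 r]])
    fix z :: complex assume z: "z \<in> cball 0 r"
    show "(?f has_field_derivative ?f z * (- complex_of_real (ln l))) (at z within cball 0 r)"
      by (auto intro!: derivative_eq_intros)
    have "cmod (?f z) \<le> exp (r * \<Lambda>)"
    proof -
      have "Re (- z * complex_of_real (ln l)) \<le> cmod (- z * complex_of_real (ln l))"
        by (rule complex_Re_le_cmod)
      also have "\<dots> = cmod z * \<bar>ln l\<bar>" by (simp add: norm_mult)
      also have "\<dots> \<le> r * \<Lambda>" using z l(2) r by (intro mult_mono) auto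
      finally show ?thesis by simp
    qed
    then have "cmod (?f z) * \<bar>ln l\<bar> \<le> exp (r * \<Lambda>) * \<Lambda>"
      using l(2) by (intro mult_mono) auto
    then show "cmod (?f z * (- complex_of_real (ln l))) \<le> \<Lambda> * exp (r * \<Lambda>)"
      by (simp add: norm_mult mult.commute)
  qed (use st in auto)
  then show ?thesis by (simp only: powr)
qed

lemma Re_sum_mset: "Re (\<Sum>x\<in>#A. f x) = (\<Sum>x\<in>#A. Re (f x))"
  and Im_sum_mset: "Im (\<Sum>x\<in>#A. f x) = (\<Sum>x\<in>#A. Im (f x))"
  by (induction A) auto

lemma norm_sum_mset_diff_le:
  fixes f g :: "'b \<Rightarrow> complex"
  assumes "\<And>l. l \<in># S \<Longrightarrow> cmod (f l - g l) \<le> d"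
  shows "cmod ((\<Sum>l\<in>#S. f l) - (\<Sum>l\<in>#S. g l)) \<le> real (size S) * d"
  using assms
proof (induction S)
  case (add x S)
  have "cmod ((f x - g x) + ((\<Sum>l\<in>#S. f l) - (\<Sum>l\<in>#S. g l))) \<le> d + real (size S) * d"
    using add by (intro norm_triangle_mono) auto
  then show ?case by (simp add: algebra_simps)
qed simp

section \<open>The limiting zeta function\<close>

text \<open>
  The constant 5 rounds up the value \<open>2 + sqrt 5\<close> at \<open>y = 4\<close>.
\<close>

lemma f_bounds:
  assumes "0 \<le> y" "y \<le> 4"
  shows "1 \<le> f_plus y" "f_plus y \<le> 5" "f_plus y * f_minus y = - 1"
proof -
  have r: "(sqrt (y\<^sup>2 + 4))\<^sup>2 = y\<^sup>2 + 4" by (rule real_sqrt_pow2) simp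
  have "y\<^sup>2 \<le> 4\<^sup>2" using assms by (intro power_mono) auto
  then have "sqrt (y\<^sup>2 + 4) \<le> 6" by (intro real_le_lsqrt) auto
  then show "f_plus y \<le> 5" using assms by (simp add: f_plus_def)
  have "2 \<le> sqrt (y\<^sup>2 + 4)" by (rule real_le_rsqrt) simp
  then show "1 \<le> f_plus y" using assms by (simp add: f_plus_def)
  show "f_plus y * f_minus y = - 1"
    using r by (simp add: f_plus_def f_minus_def power2_eq_square field_simps)
qed

lemma symbol_bounds: "0 \<le> symbol x" "symbol x \<le> 4"
  using abs_sin_le_one[of "pi * x"] by (simp_all add: abs_square_le_1)

lemma branch_square_bounds:
  assumes "0 \<le> y" "y \<le> 4"
  shows "(f_plus y)\<^sup>2 \<in> {1/25..25}" "(f_minus y)\<^sup>2 \<in> {1/25..25}" "(f_minus y)\<^sup>2 = inverse ((f_plus y)\<^sup>2)"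
proof -
  note b = f_bounds[OF assms]
  have sq: "(f_plus y)\<^sup>2 * (f_minus y)\<^sup>2 = 1"
    using b(3) by (simp flip: power_mult_distrib)
  then show inv: "(f_minus y)\<^sup>2 = inverse ((f_plus y)\<^sup>2)"
    by (metis inverse_unique)
  have "1\<^sup>2 \<le> (f_plus y)\<^sup>2" "(f_plus y)\<^sup>2 \<le> 5\<^sup>2" using b(1,2) by (intro power_mono; simp)+
  then have P: "1 \<le> (f_plus y)\<^sup>2" "(f_plus y)\<^sup>2 \<le> 25" by simp_all
  then show "(f_plus y)\<^sup>2 \<in> {1/25..25}" by simp
  have "inverse ((f_plus y)\<^sup>2) \<le> 1" using P(1) by (simp add: inverse_le_1_iff)
  moreover have "inverse 25 \<le> inverse ((f_plus y)\<^sup>2)" using P by (intro le_imp_inverse_le) auto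
  ultimately show "(f_minus y)\<^sup>2 \<in> {1/25..25}" unfolding inv by simp
qed

text \<open>
  The two branches are negative reciprocals, so \<open>s \<mapsto> -s\<close> exchanges them. This reconciles the
  exponent \<open>-s\<close> of the zeta functions with the exponent \<open>s\<close> of the limit.
\<close>

lemma powr_branch_swap:
  assumes "0 \<le> y" "y \<le> 4"
  shows "complex_of_real ((f_plus y)\<^sup>2) powr (- s) = complex_of_real ((f_minus y)\<^sup>2) powr s"
    "complex_of_real ((f_minus y)\<^sup>2) powr (- s) = complex_of_real ((f_plus y)\<^sup>2) powr s"
proof -
  note b = branch_square_bounds[OF assms]
  have pos: "0 < (f_plus y)\<^sup>2" "0 < (f_minus y)\<^sup>2" using b(1,2) by auto
  have ln: "ln ((f_minus y)\<^sup>2) = - ln ((f_plus y)\<^sup>2)"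
    unfolding b(3) by (simp only: ln_inverse)
  have powr: "complex_of_real l powr s = exp (s * complex_of_real (ln l))" if "0 < l" for l s
    using that by (simp add: powr_def Ln_of_real)
  show "complex_of_real ((f_plus y)\<^sup>2) powr (- s) = complex_of_real ((f_minus y)\<^sup>2) powr s"
    "complex_of_real ((f_minus y)\<^sup>2) powr (- s) = complex_of_real ((f_plus y)\<^sup>2) powr s"
    unfolding powr[OF pos(1)] powr[OF pos(2)] ln by simp_all
qed

context graph_complex
begin

lemma row_bounded_projections: "row_bounded G 1 PV" "row_bounded G 1 PE"
proof -
  have "(\<Sum>y\<in>G. \<bar>of_bool (x = y \<and> x \<in> X)\<bar>) \<le> (1 :: real)" if "x \<in> G" for x X
  proof -
    have "(\<Sum>y\<in>G. \<bar>of_bool (x = y \<and> x \<in> X)\<bar>) = (\<Sum>y\<in>G. if x = y then of_bool (x \<in> X) else 0 :: real)"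
      by (rule sum.cong) auto
    then show ?thesis using that by simp
  qed
  then show "row_bounded G 1 PV" "row_bounded G 1 PE" by (simp_all add: row_bounded_def)
qed

lemma row_bounded_connection:
  assumes "\<And>x. x \<in> G \<Longrightarrow> real (incidences G x) \<le> M" "0 \<le> M"
  shows "row_bounded G (2 + M + 2 * M\<^sup>2) (connection G)"
    "row_bounded G (2 + M + 2 * M\<^sup>2) (connection G - N * N)"
proof -
  note P = row_bounded_projections and H = row_bounded_hasse[OF assms(1)]
  have NN: "row_bounded G (M * M) (N * N)"
    by (rule row_bounded_mult[OF _ _ H H assms(2)]) auto
  have PENN: "row_bounded G (1 * M * M) (PE * N * N)"
    using assms(2) by (intro row_bounded_mult P H) auto
  have L: "row_bounded G (1 + 1 + M + 1 * M * M) (connection G)"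
    unfolding connection_eq by (intro row_bounded_add row_bounded_diff P H PENN)
  show "row_bounded G (2 + M + 2 * M\<^sup>2) (connection G)"
    by (rule row_bounded_mono[OF L]) (simp add: power2_eq_square)
  show "row_bounded G (2 + M + 2 * M\<^sup>2) (connection G - N * N)"
    by (rule row_bounded_mono[OF row_bounded_diff[OF L NN]]) (simp add: power2_eq_square)
qed

end

lemma connection_zeta_holomorphic: "connection_zeta G holomorphic_on UNIV"
proof -
  have "(\<lambda>s. \<Sum>l\<in>#A. complex_of_real l powr (- s)) holomorphic_on UNIV" for A
    by (induction A) (auto intro!: holomorphic_intros)
  then show ?thesis unfolding connection_zeta_def[abs_def] .
qed

context graph_tower
begin

text \<open>
  The square of the bound on the row sums of \<open>L\<close> and of its inverse, valid at all levels.
\<close>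

definition spectral_bound :: real where
  "spectral_bound = (2 + max_inc + 2 * max_inc\<^sup>2)\<^sup>2"

lemma spectral_bound_ge: "25 \<le> spectral_bound"
proof -
  have "2 \<le> max_inc" by (simp add: max_inc_def)
  then have "(5::real) \<le> 2 + max_inc + 2 * max_inc\<^sup>2"
    using power_mono[of 2 max_inc 2] by simp
  then have "5\<^sup>2 \<le> spectral_bound" unfolding spectral_bound_def by (intro power_mono) auto
  then show ?thesis by simp
qed

lemma spectrum_mem:
  assumes "l \<in># X.spectrum n"
  shows "0 < l" "l \<in> {inverse spectral_bound..spectral_bound}"
proof -
  have M: "0 \<le> max_inc" by (simp add: max_inc_def)
  have "0 \<le> 2 + max_inc + 2 * max_inc\<^sup>2" using M by simp
  note b = X.spectrum_bounds[OF X.row_bounded_connection[OF incidences_le M] this assms, folded spectral_bound_def]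
  show "0 < l" by (rule b(1))
  have "inverse spectral_bound \<le> inverse (inverse l)"
    using b(1,3) by (intro le_imp_inverse_le) auto
  then show "l \<in> {inverse spectral_bound..spectral_bound}" using b(2) by simp
qed

lemma size_spectrum_eq: "real (size (X.spectrum n)) = num_simplices n"
  by (simp add: X.size_spectrum num_simplices_def)

lemma spectrum_nonempty: "X.spectrum n \<noteq> {#}"
  using size_spectrum_eq[of n] size_pos[of n] by auto

text \<open>
  The interval that contains the spectra also contains the values of the limiting branches, so that
  approximation on it controls both.
\<close>

lemma branch_mem:
  "(f_plus (symbol x))\<^sup>2 \<in> {inverse spectral_bound..spectral_bound}"
  "(f_minus (symbol x))\<^sup>2 \<in> {inverse spectral_bound..spectral_bound}"
proof -
  have "{1/25..25} \<subseteq> {inverse spectral_bound..spectral_bound}"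
    using spectral_bound_ge le_imp_inverse_le[OF spectral_bound_ge] by auto
  then show "(f_plus (symbol x))\<^sup>2 \<in> {inverse spectral_bound..spectral_bound}"
    "(f_minus (symbol x))\<^sup>2 \<in> {inverse spectral_bound..spectral_bound}"
    using branch_square_bounds[OF symbol_bounds] by blast+
qed

lemma branch_continuous:
  "continuous_on {0..1} (\<lambda>x. (f_plus (symbol x))\<^sup>2)" "continuous_on {0..1} (\<lambda>x. (f_minus (symbol x))\<^sup>2)"
  by (intro continuous_intros)+

lemma spectral_limit:
  fixes h :: "real \<Rightarrow> real"
  assumes h: "continuous_on {inverse spectral_bound..spectral_bound} h"
  shows "(\<lambda>n. (\<Sum>l\<in>#X.spectrum n. h l) / num_simplices n)
    \<longlonglongrightarrow> integral {0..1} (\<lambda>x. (h ((f_plus (symbol x))\<^sup>2) + h ((f_minus (symbol x))\<^sup>2)) / 2)"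
  unfolding size_spectrum_eq[symmetric]
proof (rule weierstrass_moment_method[OF spectrum_mem(2) spectrum_nonempty
      branch_continuous(1) branch_mem(1) branch_continuous(2) branch_mem(2) _ h])
  fix k
  have bm: "integral {0..1} (\<lambda>x. (((f_plus (symbol x))\<^sup>2) ^ k + ((f_minus (symbol x))\<^sup>2) ^ k) / 2)
      = branch_moment 0 (2 * k)"
    unfolding branch_moment_def by (simp add: power_mult)
  show "(\<lambda>n. (\<Sum>l\<in>#X.spectrum n. l ^ k) / real (size (X.spectrum n)))
      \<longlonglongrightarrow> integral {0..1} (\<lambda>x. (((f_plus (symbol x))\<^sup>2) ^ k + ((f_minus (symbol x))\<^sup>2) ^ k) / 2)"
    using connection_moments[of 0 "2 * k"]
    unfolding bm X.spectrum_power_sum size_spectrum_eq by (simp only: mult_0_right power_0 mult_1_left)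
qed

abbreviation normalized_zeta :: "nat \<Rightarrow> complex \<Rightarrow> complex" where
  "normalized_zeta n s \<equiv> connection_zeta (X n) s / of_nat (card (X n))"

lemma normalized_zeta_pointwise: "(\<lambda>n. normalized_zeta n s) \<longlonglongrightarrow> limit_zeta s"
proof -
  let ?h = "\<lambda>l. complex_of_real l powr (- s)"
  let ?J = "{inverse spectral_bound..spectral_bound}"
  have "inverse spectral_bound > 0" using spectral_bound_ge by simp
  then have pos: "0 < l" if "l \<in> ?J" for l
    using that by (meson atLeastAtMost_iff less_le_trans)
  have h: "continuous_on ?J ?h"
  proof (rule continuous_on_eq)
    show "continuous_on ?J (\<lambda>l. exp (- s * complex_of_real (ln l)))"
      by (intro continuous_intros) (use pos in force)
    show "exp (- s * complex_of_real (ln l)) = ?h l" if "l \<in> ?J" for l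
      using pos[OF that] by (simp add: powr_def Ln_of_real)
  qed
  let ?g = "\<lambda>x. (?h ((f_plus (symbol x))\<^sup>2) + ?h ((f_minus (symbol x))\<^sup>2)) / 2"
  have g: "?g integrable_on {0..1}"
  proof (intro integrable_continuous_real continuous_on_divide continuous_on_add continuous_on_const)
    show "continuous_on {0..1} (\<lambda>x. ?h ((f_plus (symbol x))\<^sup>2))"
      by (rule continuous_on_compose2[OF h branch_continuous(1)]) (use branch_mem in blast)
    show "continuous_on {0..1} (\<lambda>x. ?h ((f_minus (symbol x))\<^sup>2))"
      by (rule continuous_on_compose2[OF h branch_continuous(2)]) (use branch_mem in blast)
  qed simp
  have lim: "limit_zeta s = integral {0..1} ?g"
    unfolding limit_zeta_def powr_branch_swap[OF symbol_bounds]
    by (simp add: add.commute flip: integral_mult_right)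
  have "(\<lambda>n. Re (normalized_zeta n s)) \<longlonglongrightarrow> Re (limit_zeta s)"
  proof -
    have "(\<lambda>n. (\<Sum>l\<in>#X.spectrum n. Re (?h l)) / num_simplices n)
        \<longlonglongrightarrow> integral {0..1} (\<lambda>x. (Re (?h ((f_plus (symbol x))\<^sup>2)) + Re (?h ((f_minus (symbol x))\<^sup>2))) / 2)"
      by (rule spectral_limit) (intro continuous_intros h)
    moreover have "integral {0..1} (\<lambda>x. (Re (?h ((f_plus (symbol x))\<^sup>2)) + Re (?h ((f_minus (symbol x))\<^sup>2))) / 2)
        = Re (limit_zeta s)"
      using integral_linear[OF g bounded_linear_Re] unfolding lim by (simp add: o_def)
    moreover have "Re (normalized_zeta n s) = (\<Sum>l\<in>#X.spectrum n. Re (?h l)) / num_simplices n" for n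
      by (simp add: connection_zeta_def Re_sum_mset num_simplices_def Re_divide_of_nat)
    ultimately show ?thesis by (simp only:)
  qed
  moreover have "(\<lambda>n. Im (normalized_zeta n s)) \<longlonglongrightarrow> Im (limit_zeta s)"
  proof -
    have "(\<lambda>n. (\<Sum>l\<in>#X.spectrum n. Im (?h l)) / num_simplices n)
        \<longlonglongrightarrow> integral {0..1} (\<lambda>x. (Im (?h ((f_plus (symbol x))\<^sup>2)) + Im (?h ((f_minus (symbol x))\<^sup>2))) / 2)"
      by (rule spectral_limit) (intro continuous_intros h)
    moreover have "integral {0..1} (\<lambda>x. (Im (?h ((f_plus (symbol x))\<^sup>2)) + Im (?h ((f_minus (symbol x))\<^sup>2))) / 2)
        = Im (limit_zeta s)"
      using integral_linear[OF g bounded_linear_Im] unfolding lim by (simp add: o_def)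
    moreover have "Im (normalized_zeta n s) = (\<Sum>l\<in>#X.spectrum n. Im (?h l)) / num_simplices n" for n
      by (simp add: connection_zeta_def Im_sum_mset num_simplices_def Im_divide_of_nat)
    ultimately show ?thesis by (simp only:)
  qed
  ultimately show ?thesis by (simp add: tendsto_complex_iff)
qed

lemma normalized_zeta_lipschitz:
  assumes "cmod s \<le> r" "cmod t \<le> r"
  shows "dist (normalized_zeta n s) (normalized_zeta n t)
    \<le> ln spectral_bound * exp (r * ln spectral_bound) * dist s t"
proof -
  let ?C = "ln spectral_bound * exp (r * ln spectral_bound) * cmod (s - t)"
  have "cmod (complex_of_real l powr (- s) - complex_of_real l powr (- t)) \<le> ?C"
    if "l \<in># X.spectrum n" for l
  proof (rule powr_lipschitz[OF _ _ assms])
    show "0 < l" by (rule spectrum_mem[OF that])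
    have pos: "0 < spectral_bound" using spectral_bound_ge by simp
    have "ln (inverse spectral_bound) \<le> ln l" "ln l \<le> ln spectral_bound"
      using spectrum_mem[OF that] pos by auto
    then show "\<bar>ln l\<bar> \<le> ln spectral_bound" using pos by (simp add: ln_inverse)
  qed
  then have "cmod (connection_zeta (X n) s - connection_zeta (X n) t) \<le> num_simplices n * ?C"
    unfolding connection_zeta_def size_spectrum_eq[symmetric] by (rule norm_sum_mset_diff_le)
  then show ?thesis
    using size_pos[of n]
    by (simp add: dist_norm num_simplices_def diff_divide_distrib[symmetric] norm_divide pos_divide_le_eq mult.commute)
qed

lemma normalized_zeta_uniform:
  assumes K: "compact K"
  shows "uniform_limit K normalized_zeta limit_zeta sequentially"
proof -
  obtain r where r: "\<And>s. s \<in> K \<Longrightarrow> cmod s \<le> r"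
    using compact_imp_bounded[OF K] by (auto simp: bounded_iff)
  show ?thesis
  proof (rule uniform_limit_lipschitz[OF K])
    show "0 \<le> ln spectral_bound * exp (r * ln spectral_bound)"
      using spectral_bound_ge by simp
  qed (use normalized_zeta_lipschitz r normalized_zeta_pointwise in auto)
qed

lemma limit_zeta_holomorphic: "limit_zeta holomorphic_on UNIV"
proof (rule holomorphic_uniform_sequence)
  show "normalized_zeta n holomorphic_on UNIV" for n
    using connection_zeta_holomorphic size_pos[of n]
    by (intro holomorphic_intros) (auto simp: num_simplices_def)
  show "\<exists>d>0. cball s d \<subseteq> UNIV \<and> uniform_limit (cball s d) normalized_zeta limit_zeta sequentially" for s
    by (intro exI[of _ 1]) (simp add: normalized_zeta_uniform)
qed simp

lemma root_measure_normalized_zeta: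
  "root_measure (normalized_zeta n) = root_measure (connection_zeta (X n))"
proof -
  define c :: complex where "c = of_nat (card (X n))"
  have "real (card (X n)) \<noteq> 0" using size_pos[of n] by (simp only: num_simplices_def)
  then have c: "c \<noteq> 0" by (simp only: c_def of_nat_eq_0_iff not_False_eq_True)
  have norm: "normalized_zeta n s = inverse c * connection_zeta (X n) s" for s
    by (simp add: c_def divide_inverse mult.commute)
  have "zorder (normalized_zeta n) w = zorder (connection_zeta (X n)) w" for w
    unfolding norm by (rule zorder_cmult) (use c in simp)
  moreover have "normalized_zeta n w = 0 \<longleftrightarrow> connection_zeta (X n) w = 0" for w
    unfolding norm using c by simp
  ultimately show ?thesis by (simp only: root_measure_def)
qed

lemma limit_zeta_zero: "limit_zeta 0 = 1"
proof -
  have "complex_of_real ((f_plus (symbol x))\<^sup>2) powr 0 + complex_of_real ((f_minus (symbol x))\<^sup>2) powr 0 = 2" for x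
    using branch_square_bounds[OF symbol_bounds, of x] by auto
  then show ?thesis by (simp add: limit_zeta_def)
qed

end

section \<open>Convergence of zeros\<close>

lemma entire_finite_zeros:
  assumes f: "f holomorphic_on UNIV" and nz: "\<exists>z. f z \<noteq> 0" and K: "compact K"
  shows "finite {z\<in>K. f z = (0::complex)}"
proof (cases "f constant_on UNIV")
  case True
  then have "{z\<in>K. f z = 0} = {}" using nz by (auto simp: constant_on_def)
  then show ?thesis by (simp only: finite.emptyI)
next
  case False
  show ?thesis by (rule holomorphic_compact_finite_zeros[OF f _ _ K _ False]) auto
qed

lemma entire_zorder_pos:
  assumes "f holomorphic_on UNIV" "\<exists>z. f z \<noteq> 0" "f w = (0::complex)"
  shows "zorder f w > 0"
  using zorder_exist_zero[of f UNIV w] assms by auto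

text \<open>
  Only zeros in the support of \<open>\<phi>\<close> count; a finite set \<open>S\<close> of zeros beyond these may be used, which
  frees later sums from cutting off at the boundary of the support.
\<close>

lemma integral_root_measure:
  fixes \<phi> :: "complex \<Rightarrow> real"
  assumes f: "f holomorphic_on UNIV" "\<exists>z. f z \<noteq> 0" and \<phi>: "continuous_on UNIV \<phi>"
    and S: "finite S" "\<And>w. w \<in> S \<Longrightarrow> f w = 0" "\<And>w. f w = 0 \<Longrightarrow> \<phi> w \<noteq> 0 \<Longrightarrow> w \<in> S"
  shows "integral\<^sup>L (root_measure f) \<phi> = (\<Sum>w\<in>S. real_of_int (zorder f w) * \<phi> w)"
proof -
  let ?Z = "{w. f w = 0}" and ?m = "\<lambda>w. real (nat (zorder f w))"
  have borel: "\<phi> \<in> borel_measurable borel" using \<phi> by (rule borel_measurable_continuous_onI)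
  have "integral\<^sup>L (root_measure f) \<phi> = integral\<^sup>L (point_measure ?Z (\<lambda>w. ennreal (?m w))) \<phi>"
    unfolding root_measure_def
    by (subst integral_distr) (auto simp: borel measurable_point_measure_eq1 ennreal_of_nat_eq_real_of_nat)
  also have "\<dots> = (\<integral>w. ?m w *\<^sub>R \<phi> w \<partial>count_space ?Z)"
    unfolding point_measure_def by (rule integral_density) auto
  also have "\<dots> = (\<Sum>w | w \<in> ?Z \<and> ?m w *\<^sub>R \<phi> w \<noteq> 0. ?m w *\<^sub>R \<phi> w)"
    by (rule lebesgue_integral_count_space_finite_support)
       (rule finite_subset[OF _ S(1)], use S(3) in auto)
  also have "\<dots> = (\<Sum>w\<in>S. ?m w * \<phi> w)"
    by (rule sum.mono_neutral_cong_left) (use S in auto)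
  also have "\<dots> = (\<Sum>w\<in>S. real_of_int (zorder f w) * \<phi> w)"
    using entire_zorder_pos[OF f S(2)] by (intro sum.cong) (simp_all add: less_imp_le)
  finally show ?thesis .
qed

text \<open>
  Rouche's theorem on the circle, where \<open>F n - g\<close> is eventually smaller than \<open>g\<close>.
\<close>

lemma hurwitz_count:
  fixes F :: "nat \<Rightarrow> complex \<Rightarrow> complex"
  assumes F: "\<And>n. F n holomorphic_on UNIV" and g: "g holomorphic_on UNIV"
    and lim: "uniform_limit (sphere z r) F g sequentially"
    and r: "0 < r" and nz: "\<And>w. w \<in> sphere z r \<Longrightarrow> g w \<noteq> 0"
  shows "\<forall>\<^sub>F n in sequentially.
    (\<Sum>w | w \<in> ball z r \<and> F n w = 0. zorder (F n) w) = (\<Sum>w | w \<in> ball z r \<and> g w = 0. zorder g w)"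
proof -
  have cont: "continuous_on (sphere z r) (\<lambda>w. cmod (g w))"
    by (intro continuous_intros holomorphic_on_imp_continuous_on holomorphic_on_subset[OF g]) auto
  have ne: "sphere z r \<noteq> {}" using r by simp
  obtain w0 where w0: "w0 \<in> sphere z r" "\<And>w. w \<in> sphere z r \<Longrightarrow> cmod (g w0) \<le> cmod (g w)"
    using continuous_attains_inf[OF compact_sphere ne cont] by blast
  have "cmod (g w0) > 0" using nz[OF w0(1)] by simp
  from uniform_limitD[OF lim this]
  show ?thesis
  proof (rule eventually_mono)
    fix n assume close: "\<forall>w\<in>sphere z r. dist (F n w) (g w) < cmod (g w0)"
    define h where "h w = F n w - g w" for w
    have gh: "g w + h w = F n w" for w by (simp add: h_def)
    have hg: "cmod (h w) < cmod (g w)" if "w \<in> sphere z r" for w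
      using close that w0(2)[OF that] by (force simp: h_def dist_norm)
    (* an open disc around the circle; zeros in the outer annulus have winding number 0 *)
    let ?s = "ball z (r + 1)"
    have Fw0: "F n w0 \<noteq> 0"
    proof
      assume "F n w0 = 0"
      then show False using hg[OF w0(1)] by (simp add: h_def)
    qed
    have fin: "finite {w\<in>?s. k w = 0}" if "k holomorphic_on UNIV" "k w0 \<noteq> 0" for k :: "complex \<Rightarrow> complex"
      by (rule finite_subset[OF _ entire_finite_zeros[OF that(1) _ compact_cball[of z "r + 1"]]])
         (use that(2) in auto)
    have rouche: "(\<Sum>p\<in>{p\<in>?s. g p + h p = 0}. winding_number (circlepath z r) p * zorder (\<lambda>p. g p + h p) p)
        = (\<Sum>p\<in>{p\<in>?s. g p = 0}. winding_number (circlepath z r) p * zorder g p)"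
    proof (rule Rouche_theorem)
      show "finite {p\<in>?s. g p + h p = 0}" using fin[OF F[of n] Fw0] by (simp add: h_def)
      show "finite {p\<in>?s. g p = 0}" using fin[OF g] nz[OF w0(1)] by simp
      show "g holomorphic_on ?s" "h holomorphic_on ?s"
        unfolding h_def by (intro holomorphic_intros holomorphic_on_subset[OF F] holomorphic_on_subset[OF g]; simp)+
      show "path_image (circlepath z r) \<subseteq> ?s" using r by auto
      show "\<forall>w\<in>path_image (circlepath z r). cmod (h w) < cmod (g w)" using hg r by auto
      show "\<forall>w. w \<notin> ?s \<longrightarrow> winding_number (circlepath z r) w = 0"
      proof (intro allI impI)
        fix w assume "w \<notin> ?s"
        then show "winding_number (circlepath z r) w = 0"
          using r by (intro winding_number_zero_outside[of _ "cball z r"]) auto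
      qed
    qed auto
    have count: "(\<Sum>p\<in>{p\<in>?s. k p = 0}. winding_number (circlepath z r) p * zorder k p)
        = of_int (\<Sum>w | w \<in> ball z r \<and> k w = 0. zorder k w)"
      if k: "k holomorphic_on UNIV" "k w0 \<noteq> 0" "\<And>w. w \<in> sphere z r \<Longrightarrow> k w \<noteq> 0" for k
    proof -
      have "(\<Sum>p\<in>{p\<in>?s. k p = 0}. winding_number (circlepath z r) p * zorder k p)
          = (\<Sum>p\<in>{p\<in>ball z r. k p = 0}. of_int (zorder k p))"
      proof (rule sum.mono_neutral_cong_right)
        show "finite {p\<in>?s. k p = 0}" by (rule fin[OF k(1,2)])
        show "{p\<in>ball z r. k p = 0} \<subseteq> {p\<in>?s. k p = 0}" by auto
        show "\<forall>p\<in>{p\<in>?s. k p = 0} - {p\<in>ball z r. k p = 0}.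
            winding_number (circlepath z r) p * zorder k p = 0"
        proof
          fix p assume p: "p \<in> {p\<in>?s. k p = 0} - {p\<in>ball z r. k p = 0}"
          then have "p \<notin> cball z r" using k(3)[of p] by (force simp: dist_norm)
          then have "winding_number (circlepath z r) p = 0"
            using r by (intro winding_number_zero_outside[of _ "cball z r"]) auto
          then show "winding_number (circlepath z r) p * zorder k p = 0" by simp
        qed
        fix p assume "p \<in> {p\<in>ball z r. k p = 0}"
        then have "winding_number (circlepath z r) p = 1"
          by (intro winding_number_circlepath) (auto simp: dist_norm norm_minus_commute)
        then show "winding_number (circlepath z r) p * zorder k p = of_int (zorder k p)" by simp
      qed
      then show ?thesis by simp
    qed
    have Fnz: "F n w \<noteq> 0" if "w \<in> sphere z r" for w
      using hg[OF that] by (auto simp: h_def)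
    have "of_int (\<Sum>w | w \<in> ball z r \<and> F n w = 0. zorder (F n) w)
        = (\<Sum>p\<in>{p\<in>?s. F n p = 0}. winding_number (circlepath z r) p * zorder (F n) p)"
      by (rule count[symmetric]) (use F Fw0 Fnz in auto)
    also have "\<dots> = (\<Sum>p\<in>{p\<in>?s. g p = 0}. winding_number (circlepath z r) p * zorder g p)"
      using rouche unfolding gh .
    also have "\<dots> = of_int (\<Sum>w | w \<in> ball z r \<and> g w = 0. zorder g w)"
      by (rule count) (use g nz w0 in auto)
    finally have "of_int (\<Sum>w | w \<in> ball z r \<and> F n w = 0. zorder (F n) w)
        = (of_int (\<Sum>w | w \<in> ball z r \<and> g w = 0. zorder g w) :: complex)" .
    then show "(\<Sum>w | w \<in> ball z r \<and> F n w = 0. zorder (F n) w) = (\<Sum>w | w \<in> ball z r \<and> g w = 0. zorder g w)"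
      by (simp only: of_int_eq_iff)
  qed
qed

text \<open>
  Around each zero of \<open>g\<close> in a large disc, choose a ball on which \<open>\<phi>\<close> is nearly constant. Eventually \<open>F n\<close>
  has as many zeros in this ball as the multiplicity of its centre, and none elsewhere in the disc.
\<close>

lemma root_measures_converge:
  fixes F :: "nat \<Rightarrow> complex \<Rightarrow> complex" and \<phi> :: "complex \<Rightarrow> real"
  assumes F: "\<And>n. F n holomorphic_on UNIV" and g: "g holomorphic_on UNIV" "\<exists>z. g z \<noteq> 0"
    and lim: "\<And>K. compact K \<Longrightarrow> uniform_limit K F g sequentially"
    and \<phi>: "continuous_on UNIV \<phi>" "compact (closure {w. \<phi> w \<noteq> 0})"
  shows "(\<lambda>n. integral\<^sup>L (root_measure (F n)) \<phi>) \<longlonglongrightarrow> integral\<^sup>L (root_measure g) \<phi>"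
proof -
  obtain B where B: "\<And>w. \<phi> w \<noteq> 0 \<Longrightarrow> w \<in> cball 0 B"
  proof -
    have "bounded {w. \<phi> w \<noteq> 0}"
      using \<phi>(2) bounded_subset[OF compact_imp_bounded closure_subset] by blast
    then show ?thesis using that by (auto simp: bounded_iff)
  qed
  define Z where "Z = {w\<in>cball 0 B. g w = 0}"
  have Z: "finite Z" unfolding Z_def by (rule entire_finite_zeros[OF g compact_cball])
  have g_cont: "continuous_on UNIV g" by (rule holomorphic_on_imp_continuous_on[OF g(1)])
  have intg: "integral\<^sup>L (root_measure g) \<phi> = (\<Sum>w\<in>Z. real_of_int (zorder g w) * \<phi> w)"
    by (rule integral_root_measure[OF g \<phi>(1) Z]) (use B in \<open>auto simp: Z_def\<close>)
  define T where "T = (\<Sum>w\<in>Z. real_of_int (zorder g w))"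
  have T: "T \<ge> 0"
    unfolding T_def using entire_zorder_pos[OF g] by (intro sum_nonneg) (auto simp: Z_def less_imp_le)
  show ?thesis
  proof (rule tendstoI)
    fix \<epsilon> :: real assume "\<epsilon> > 0"
    (* the error made at each zero is e times its multiplicity; T bounds the total multiplicity *)
    define e where "e = \<epsilon> / (T + 1)"
    have e: "e > 0" using \<open>\<epsilon> > 0\<close> T by (simp add: e_def)
    have local: "\<forall>\<^sub>F r in at_right 0. (\<forall>v\<in>cball w r - {w}. g v \<noteq> 0) \<and> (\<forall>v\<in>cball w r. \<bar>\<phi> v - \<phi> w\<bar> < e)
        \<and> (\<forall>w'\<in>Z - {w}. cball w r \<inter> cball w' r = {})" for w
    proof (intro eventually_conj)
      obtain d where d: "d > 0" "\<forall>v\<in>{v\<in>cball w 1. g v = 0}. v \<noteq> w \<longrightarrow> d \<le> dist w v"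
        using finite_set_avoid[OF entire_finite_zeros[OF g compact_cball[of w 1]], of w] by blast
      show "\<forall>\<^sub>F r in at_right 0. \<forall>v\<in>cball w r - {w}. g v \<noteq> 0"
      proof (rule eventually_at_rightI)
        fix r assume r: "r \<in> {0<..<min d 1}"
        show "\<forall>v\<in>cball w r - {w}. g v \<noteq> 0"
        proof
          fix v assume v: "v \<in> cball w r - {w}"
          show "g v \<noteq> 0"
          proof
            assume "g v = 0"
            then have "d \<le> dist w v" using v r d(2) by auto
            then show False using v r by auto
          qed
        qed
      qed (use d in simp)
      obtain d' where d': "d' > 0" "\<And>v. dist v w < d' \<Longrightarrow> dist (\<phi> v) (\<phi> w) < e"
        using \<phi>(1) e unfolding continuous_on_iff by blast
      show "\<forall>\<^sub>F r in at_right 0. \<forall>v\<in>cball w r. \<bar>\<phi> v - \<phi> w\<bar> < e"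
      proof (rule eventually_at_rightI)
        fix r assume r: "r \<in> {0<..<d'}"
        show "\<forall>v\<in>cball w r. \<bar>\<phi> v - \<phi> w\<bar> < e"
        proof
          fix v assume "v \<in> cball w r"
          then have "dist v w < d'" using r by (simp add: dist_commute)
          from d'(2)[OF this] show "\<bar>\<phi> v - \<phi> w\<bar> < e" by (simp add: dist_real_def)
        qed
      qed (use d' in simp)
      obtain d'' where d'': "d'' > 0" "\<forall>w'\<in>Z. w' \<noteq> w \<longrightarrow> d'' \<le> dist w w'"
        using finite_set_avoid[OF Z, of w] by blast
      show "\<forall>\<^sub>F r in at_right 0. \<forall>w'\<in>Z - {w}. cball w r \<inter> cball w' r = {}"
      proof (rule eventually_at_rightI)
        fix r assume r: "r \<in> {0<..<d'' / 2}"
        show "\<forall>w'\<in>Z - {w}. cball w r \<inter> cball w' r = {}"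
        proof (rule ballI, rule ccontr)
          fix w' assume w': "w' \<in> Z - {w}" and "cball w r \<inter> cball w' r \<noteq> {}"
          then obtain v where "dist w v \<le> r" "dist w' v \<le> r" by auto
          then have "dist w w' \<le> r + r" using dist_triangle2[of w w' v] by linarith
          then show False using d''(2) w' r by force
        qed
      qed (use d'' in simp)
    qed
    have ev: "\<forall>\<^sub>F r in at_right 0. r > (0::real) \<and> (\<forall>w\<in>Z. (\<forall>v\<in>cball w r - {w}. g v \<noteq> 0) \<and> (\<forall>v\<in>cball w r. \<bar>\<phi> v - \<phi> w\<bar> < e)
        \<and> (\<forall>w'\<in>Z - {w}. cball w r \<inter> cball w' r = {}))"
      by (intro eventually_conj eventually_at_right_less eventually_ball_finite Z ballI local)
    obtain r where r0: "r > 0 \<and> (\<forall>w\<in>Z. (\<forall>v\<in>cball w r - {w}. g v \<noteq> 0)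
        \<and> (\<forall>v\<in>cball w r. \<bar>\<phi> v - \<phi> w\<bar> < e) \<and> (\<forall>w'\<in>Z - {w}. cball w r \<inter> cball w' r = {}))"
      using eventually_happens'[OF trivial_limit_at_right_real ev] by (rule exE)
    note rZ = bspec[OF conjunct2[OF r0]]
    have r: "r > 0" using r0 by (rule conjunct1)
    have r_zero: "g v \<noteq> 0" if "w \<in> Z" "v \<in> cball w r" "v \<noteq> w" for w v
      using conjunct1[OF rZ[OF that(1)]] that(2,3) by blast
    have r_\<phi>: "\<bar>\<phi> v - \<phi> w\<bar> < e" if "w \<in> Z" "v \<in> cball w r" for w v
      using conjunct1[OF conjunct2[OF rZ[OF that(1)]]] that(2) by (rule bspec)
    have r_disjoint: "cball w r \<inter> cball w' r = {}" if "w \<in> Z" "w' \<in> Z" "w \<noteq> w'" for w w'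
      using conjunct2[OF conjunct2[OF rZ[OF that(1)]]] that(2,3) by blast
    have counts: "\<forall>\<^sub>F n in sequentially. \<forall>w\<in>Z.
        (\<Sum>v | v \<in> ball w r \<and> F n v = 0. zorder (F n) v) = zorder g w"
    proof (intro eventually_ball_finite Z ballI)
      fix w assume w: "w \<in> Z"
      have "v = w" if "v \<in> ball w r" "g v = 0" for v
        using r_zero[OF w, of v] that by fastforce
      moreover have "w \<in> ball w r" "g w = 0" using r w by (simp_all add: Z_def)
      ultimately have Zw: "{v. v \<in> ball w r \<and> g v = 0} = {w}" by blast
      have "g v \<noteq> 0" if "v \<in> sphere w r" for v
        by (rule r_zero[OF w]) (use that r in auto)
      then have "\<forall>\<^sub>F n in sequentially. (\<Sum>v | v \<in> ball w r \<and> F n v = 0. zorder (F n) v)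
          = (\<Sum>v | v \<in> ball w r \<and> g v = 0. zorder g v)"
        by (rule hurwitz_count[OF F g(1) lim[OF compact_sphere] r])
      then show "\<forall>\<^sub>F n in sequentially. (\<Sum>v | v \<in> ball w r \<and> F n v = 0. zorder (F n) v) = zorder g w"
        unfolding Zw by simp
    qed
    define C where "C = cball 0 B - (\<Union>w\<in>Z. ball w r)"
    have C: "compact C" unfolding C_def by (intro compact_diff compact_cball open_UN ballI open_ball)
    have gC: "g w \<noteq> 0" if "w \<in> C" for w using that r by (auto simp: C_def Z_def)
    have "\<exists>m>0. \<forall>w\<in>C. m \<le> cmod (g w)"
    proof (cases "C = {}")
      case False
      then obtain w0 where "w0 \<in> C" "\<And>w. w \<in> C \<Longrightarrow> cmod (g w0) \<le> cmod (g w)"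
        using continuous_attains_inf[OF C False continuous_on_norm[OF continuous_on_subset[OF g_cont]]]
        by auto
      then show ?thesis using gC by (intro exI[of _ "cmod (g w0)"]) auto
    qed (intro exI[of _ 1], simp)
    then obtain m where m: "m > 0" "\<And>w. w \<in> C \<Longrightarrow> m \<le> cmod (g w)" by blast
    have noC: "\<forall>\<^sub>F n in sequentially. \<forall>w\<in>C. F n w \<noteq> 0"
      using uniform_limitD[OF lim[OF C] m(1)]
    proof (rule eventually_mono)
      fix n assume *: "\<forall>w\<in>C. dist (F n w) (g w) < m"
      show "\<forall>w\<in>C. F n w \<noteq> 0" using * m(2) by (force simp: dist_norm)
    qed
    obtain z0 where z0: "g z0 \<noteq> 0" using g(2) by blast
    have nonzero: "\<forall>\<^sub>F n in sequentially. F n z0 \<noteq> 0"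
    proof -
      have "(\<lambda>n. F n z0) \<longlonglongrightarrow> g z0"
        using tendsto_uniform_limitI[OF lim[OF compact_sing[of z0]]] by simp
      then show ?thesis using z0 by (rule tendsto_imp_eventually_ne)
    qed
    show "\<forall>\<^sub>F n in sequentially. dist (integral\<^sup>L (root_measure (F n)) \<phi>) (integral\<^sup>L (root_measure g) \<phi>) < \<epsilon>"
      using counts noC nonzero
    proof eventually_elim
      case (elim n)
      have nzF: "\<exists>z. F n z \<noteq> 0" using elim(3) by blast
      let ?S = "\<lambda>w. {v. v \<in> ball w r \<and> F n v = 0}"
      have finS: "finite (?S w)" for w
        by (rule finite_subset[OF _ entire_finite_zeros[OF F nzF compact_cball[of w r]]]) auto
      have disj: "?S w \<inter> ?S w' = {}" if "w \<in> Z" "w' \<in> Z" "w \<noteq> w'" for w w'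
        using r_disjoint[OF that] ball_subset_cball by blast
      have "integral\<^sup>L (root_measure (F n)) \<phi>
          = (\<Sum>v\<in>(\<Union>w\<in>Z. ?S w). real_of_int (zorder (F n) v) * \<phi> v)"
      proof (rule integral_root_measure[OF F nzF \<phi>(1)])
        fix v assume v: "F n v = 0" "\<phi> v \<noteq> 0"
        then have "v \<notin> C" using elim(2) by blast
        then have "v \<in> (\<Union>w\<in>Z. ball w r)" using B[OF v(2)] by (auto simp: C_def)
        then show "v \<in> (\<Union>w\<in>Z. ?S w)" using v(1) by auto
      qed (use finS Z in auto)
      also have "\<dots> = (\<Sum>w\<in>Z. \<Sum>v\<in>?S w. real_of_int (zorder (F n) v) * \<phi> v)"
        by (rule sum.UNION_disjoint) (use Z finS disj in auto)
      finally have I: "integral\<^sup>L (root_measure (F n)) \<phi>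
          = (\<Sum>w\<in>Z. \<Sum>v\<in>?S w. real_of_int (zorder (F n) v) * \<phi> v)" .
      have "\<bar>(\<Sum>v\<in>?S w. real_of_int (zorder (F n) v) * \<phi> v) - real_of_int (zorder g w) * \<phi> w\<bar>
          \<le> real_of_int (zorder g w) * e" if w: "w \<in> Z" for w
      proof -
        have zg: "real_of_int (zorder g w) = (\<Sum>v\<in>?S w. real_of_int (zorder (F n) v))"
          using elim(1) w by (simp flip: of_int_sum)
        have "\<bar>(\<Sum>v\<in>?S w. real_of_int (zorder (F n) v) * \<phi> v) - real_of_int (zorder g w) * \<phi> w\<bar>
            = \<bar>\<Sum>v\<in>?S w. real_of_int (zorder (F n) v) * (\<phi> v - \<phi> w)\<bar>"
          unfolding zg by (simp add: sum_distrib_right sum_subtractf right_diff_distrib)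
        also have "\<dots> \<le> (\<Sum>v\<in>?S w. \<bar>real_of_int (zorder (F n) v) * (\<phi> v - \<phi> w)\<bar>)"
          by (rule sum_abs)
        also have "\<dots> \<le> (\<Sum>v\<in>?S w. real_of_int (zorder (F n) v) * e)"
        proof (rule sum_mono)
          fix v assume v: "v \<in> ?S w"
          then have "zorder (F n) v > 0" "\<bar>\<phi> v - \<phi> w\<bar> < e"
            using entire_zorder_pos[OF F nzF] r_\<phi>[OF w] by auto
          then show "\<bar>real_of_int (zorder (F n) v) * (\<phi> v - \<phi> w)\<bar> \<le> real_of_int (zorder (F n) v) * e"
            by (simp add: abs_mult)
        qed
        also have "\<dots> = real_of_int (zorder g w) * e" by (simp only: zg sum_distrib_right)
        finally show ?thesis .
      qed
      then have "(\<Sum>w\<in>Z. \<bar>(\<Sum>v\<in>?S w. real_of_int (zorder (F n) v) * \<phi> v) - real_of_int (zorder g w) * \<phi> w\<bar>)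
          \<le> (\<Sum>w\<in>Z. real_of_int (zorder g w) * e)"
        by (rule sum_mono)
      then have "dist (integral\<^sup>L (root_measure (F n)) \<phi>) (integral\<^sup>L (root_measure g) \<phi>) \<le> T * e"
        unfolding I intg dist_real_def sum_subtractf[symmetric] T_def sum_distrib_right
        by (rule order.trans[OF sum_abs])
      also have "T * e < \<epsilon>" using T \<open>\<epsilon> > 0\<close> by (simp add: e_def field_simps)
      finally show ?case .
    qed
  qed
qed

section \<open>Iterated refinements of a complex\<close>

lemma graph_tower_refined_complex:
  assumes "finite_simplicial_complex G" and "one_dimensional G"
  shows "graph_tower (refined_complex G) (\<lambda>_. simplex_vertex)"
proof -
  have zero: "graph_complex (refined_complex G 0)"
  proof
    show "finite_simplicial_complex (refined_complex G 0)"
      by (rule finite_simplicial_complex_refined_complex[OF assms(1)])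
    show "card x \<le> 2" if "x \<in> refined_complex G 0" for x
      using that assms(2) by (auto simp: one_dimensional_def card_image inj_on_def)
  qed
  have ref: "graph_refinement (refined_complex G n) simplex_vertex" if "graph_complex (refined_complex G n)" for n
  proof -
    interpret graph_complex "refined_complex G n" by (rule that)
    show ?thesis
      by unfold_locales (rule inj_on_subset[OF inj_on_simplex_vertex], use simplex_finite in auto)
  qed
  have step: "refined_complex G (Suc n) = graph_refinement.R (refined_complex G n) simplex_vertex"
    if "graph_refinement (refined_complex G n) simplex_vertex" for n
    using graph_refinement.R_def[OF that] by simp
  have all: "graph_refinement (refined_complex G n) simplex_vertex" for n
  proof (induction n)
    case (Suc n)
    interpret graph_refinement "refined_complex G n" simplex_vertex by (rule Suc.IH)
    show ?case
      by (rule ref) (use step[OF Suc.IH] R.graph_complex_axioms in \<open>simp only:\<close>)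
  qed (rule ref[OF zero])
  obtain x where x: "x \<in> G" "card x = 2" using assms(2) by (auto simp: one_dimensional_def)
  then have "Original ` x \<in> edges (refined_complex G 0)"
    by (auto simp: edges_def card_image inj_on_def)
  then show ?thesis
    by (intro graph_tower.intro all step) auto
qed

theorem theorem2:
  fixes G :: "'a set set"
  assumes "finite_simplicial_complex G" and "one_dimensional G"
  shows "limit_zeta holomorphic_on UNIV
    \<and> (\<forall>K. compact K \<longrightarrow>
         uniform_limit K
           (\<lambda>n s. connection_zeta (refined_complex G n) s / of_nat (card (refined_complex G n)))
           limit_zeta sequentially)
    \<and> (\<forall>\<phi> :: complex \<Rightarrow> real. continuous_on UNIV \<phi> \<and> compact (closure {w. \<phi> w \<noteq> 0}) \<longrightarrow>
         (\<lambda>n. integral\<^sup>L (root_measure (connection_zeta (refined_complex G n))) \<phi>)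
           \<longlonglongrightarrow> integral\<^sup>L (root_measure limit_zeta) \<phi>)"
proof -
  interpret graph_tower "refined_complex G" "\<lambda>_. simplex_vertex"
    by (rule graph_tower_refined_complex[OF assms])
  have nonzero: "\<exists>z. limit_zeta z \<noteq> 0" using limit_zeta_zero by (intro exI[of _ 0]) simp
  have holo: "normalized_zeta n holomorphic_on UNIV" for n
    using connection_zeta_holomorphic size_pos[of n]
    by (intro holomorphic_intros) (auto simp: num_simplices_def)
  have "(\<lambda>n. integral\<^sup>L (root_measure (connection_zeta (refined_complex G n))) \<phi>)
      \<longlonglongrightarrow> integral\<^sup>L (root_measure limit_zeta) \<phi>"
    if "continuous_on UNIV \<phi>" "compact (closure {w. \<phi> w \<noteq> 0})" for \<phi> :: "complex \<Rightarrow> real"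
    using root_measures_converge[OF holo limit_zeta_holomorphic nonzero normalized_zeta_uniform that]
    by (simp only: root_measure_normalized_zeta)
  then show ?thesis using limit_zeta_holomorphic normalized_zeta_uniform by blast
qed

end
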